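(* Let $n,d\ge 1$. A non-empty collection of subgraphs $t_1,\dots,t_k$ of the complete bipartite graph $K_{n,d}$ encodes a triangulation of $\Delta_{n-1}\times\Delta_{d-1}$ if and only if: 1. Each $t_i$ is a spanning tree. 2. For each $t_i$ and each internal edge $e$ of $t_i$, there exist an edge $f\neq e$ and a tree $t_j$ with $t_j=(t_i-e)\cup f$. 3. There do not exist two trees $t_i$ and $t_j$, and a circuit $C$ of $K_{n,d}$ which alternates between edges of $t_i$ and edges of $t_j$.
   Context: Let $v_1,\dots,v_n$ and $w_1,\dots,w_d$ be the vertices of the simplices $\Delta_{n-1}$ and $\Delta_{d-1}$, so the vertices of the polytope $\Delta_{n-1}\times\Delta_{d-1}$ are the $v_i\times w_j$. $K_{n,d}$ has vertices $v_1,\dots,v_n,w_1,\dots,w_d$, and its edge $v_iw_j$ corresponds to the vertex $v_i\times w_j$ of the polytope. A set of vertices of $\Delta_{n-1}\times\Delta_{d-1}$ thus determines a subgraph of $K_{n,d}$ (on all $n+d$ vertices, with the corresponding edges). A collection of subgraphs encodes a triangulation of $\Delta_{n-1}\times\Delta_{d-1}$ if the corresponding sets of vertices are the vertex sets of the full-dimensional simplices of a triangulation of $\Delta_{n-1}\times\Delta_{d-1}$ that uses only vertices of the polytope. An edge of a tree is internal if it is not adjacent to a leaf (i.e. neither endpoint is a leaf). A circuit is a simple cycle; it alternates between edges of $t_i$ and edges of $t_j$ if, going around it, its edges alternately belong to $t_i$ and to $t_j$ (edges may belong to both). *)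

theory Defs
  imports "HOL-Analysis.Analysis"
begin

section \<open>Undirected graphs\<close>

text \<open>
  A simple graph is given by a vertex set and a set of two-element sets (its edges).
\<close>

definition graph_connected :: "'a set \<Rightarrow> 'a set set \<Rightarrow> bool" where
  "graph_connected V E \<longleftrightarrow>
     V \<noteq> {} \<and> (\<forall>x\<in>V. \<forall>y\<in>V. (x, y) \<in> {(u, v). {u, v} \<in> E}\<^sup>*)"

text \<open>A circuit is the cyclic list of its vertices; its \<open>k\<close>-th edge (counting from 0) joins
  the entries \<open>k\<close> and \<open>k + 1\<close>, the last edge closing up to the first entry.\<close>

definition circuit_edge :: "'a list \<Rightarrow> nat \<Rightarrow> 'a set" where
  "circuit_edge c k = {c ! k, c ! (Suc k mod length c)}"

definition is_circuit :: "'a set set \<Rightarrow> 'a list \<Rightarrow> bool" where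
  "is_circuit E c \<longleftrightarrow>
     3 \<le> length c \<and> distinct c \<and> (\<forall>k<length c. circuit_edge c k \<in> E)"

definition is_spanning_tree :: "'a set \<Rightarrow> 'a set set \<Rightarrow> 'a set set \<Rightarrow> bool" where
  "is_spanning_tree V E t \<longleftrightarrow>
     t \<subseteq> E \<and> graph_connected V t \<and> \<not> (\<exists>c. is_circuit t c)"

definition is_leaf :: "'a set set \<Rightarrow> 'a \<Rightarrow> bool" where
  "is_leaf t x \<longleftrightarrow> card {e \<in> t. x \<in> e} = 1"

definition internal_edge :: "'a set set \<Rightarrow> 'a set \<Rightarrow> bool" where
  "internal_edge t e \<longleftrightarrow> e \<in> t \<and> (\<forall>x\<in>e. \<not> is_leaf t x)"

text \<open>The roles of \<open>s\<close> and \<open>t\<close> are not symmetric here, but rotating the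
  list \<open>c\<close> by one position exchanges them.\<close>

definition alternates :: "'a set set \<Rightarrow> 'a set set \<Rightarrow> 'a list \<Rightarrow> bool" where
  "alternates s t c \<longleftrightarrow>
     even (length c) \<and>
     (\<forall>k<length c. circuit_edge c k \<in> (if even k then s else t))"

section \<open>Subgraphs of the complete bipartite graph and sets of vertices of the product\<close>

text \<open>
  The numbers \<open>n, d \<ge> 1\<close> are the cardinalities of the finite types \<open>'n\<close> and \<open>'d\<close>.
  The complete bipartite graph has vertex set \<open>UNIV :: ('n + 'd) set\<close>, with \<open>Inl i\<close> for
  \<open>v\<^sub>i\<close> and \<open>Inr j\<close> for \<open>w\<^sub>j\<close>. All subgraphs are on the full vertex set, so a
  subgraph is identified with its set of edges.
\<close>

definition K_edges :: "('n::finite + 'd::finite) set set" where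
  "K_edges = {{Inl i, Inr j} | i j. True}"

definition std_simplex :: "(real ^ 'n::finite) set" where
  "std_simplex = convex hull (range (\<lambda>i. axis i 1))"

definition simplex_product :: "((real ^ 'n::finite) \<times> (real ^ 'd::finite)) set" where
  "simplex_product = std_simplex \<times> std_simplex"

definition subgraph_points ::
    "('n::finite + 'd::finite) set set \<Rightarrow> ((real ^ 'n) \<times> (real ^ 'd)) set" where
  "subgraph_points t = {(axis i 1, axis j 1) | i j. {Inl i, Inr j} \<in> t}"

section \<open>Triangulations\<close>

definition vertex_set :: "'a::euclidean_space set \<Rightarrow> 'a set" where
  "vertex_set P = {x. x extreme_point_of P}"

text \<open>The library predicate \<open>triangulation\<close> does not require the faces of members to be
  members; \<open>simplicial_complex\<close> does, and neither prescribes the union.\<close>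

definition triangulates_without_new_vertices ::
    "'a::euclidean_space set set \<Rightarrow> 'a set \<Rightarrow> bool" where
  "triangulates_without_new_vertices \<K> P \<longleftrightarrow>
     simplicial_complex \<K> \<and> \<Union>\<K> = P \<and> (\<forall>S\<in>\<K>. vertex_set S \<subseteq> vertex_set P)"

definition encodes_triangulation :: "('n::finite + 'd::finite) set set set \<Rightarrow> bool" where
  "encodes_triangulation T \<longleftrightarrow>
     (\<exists>\<K>. triangulates_without_new_vertices \<K>
             (simplex_product :: ((real ^ 'n) \<times> (real ^ 'd)) set) \<and>
          subgraph_points ` T =
            vertex_set ` {S \<in> \<K>. aff_dim S =
              aff_dim (simplex_product :: ((real ^ 'n) \<times> (real ^ 'd)) set)})"

end

theory Submission
  imports Defs
begin

text \<open>
  Identify the vertex \<open>v\<^sub>i \<times> w\<^sub>j\<close> of the polytope with the sum of two standard basis vectors, one for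
  each end of the edge. A linear relation between these points is a weighting of the edges whose
  sum at every vertex of the graph vanishes. Leaving each vertex along an edge of the opposite sign
  to the one by which it was entered, one finds a circuit along which the signs alternate. So the
  absence of alternating circuits says exactly that two nonnegative combinations supported on
  trees of the collection agree only if they have the same coefficients; equivalently, the simplices
  meet along common faces, and acyclic graphs give linearly independent points.

  In a triangulation, stepping slightly across the facet opposite an internal edge \<open>e\<close> stays in the
  polytope, because every vertex of the graph still has an edge in \<open>t - e\<close>; the simplex met there
  provides the exchange. Conversely, to see that the simplices cover the polytope, walk from a
  generic point of one simplex to a generic target. Genericity keeps the segment away from faces
  of codimension two, and whenever it leaves a simplex through a facet, the exchange provides a
  simplex on the other side of that facet.
\<close>

section \<open>Finite families of simplicial cones\<close>

text \<open>Determined only on \<open>span B\<close>; elsewhere some linear extension is chosen.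
  Hence cone membership has to be tested together with membership in the span.\<close>

definition coord :: "'a::real_vector set \<Rightarrow> 'a \<Rightarrow> 'a \<Rightarrow> real" where
  "coord B b = (SOME g. linear g \<and> (\<forall>c\<in>B. g c = (if c = b then 1 else 0)))"

lemma coord_props:
  assumes "independent B"
  shows "linear (coord B b)" and "\<And>c. c \<in> B \<Longrightarrow> coord B b c = (if c = b then 1 else 0)"
proof -
  have "\<exists>g. linear g \<and> (\<forall>c\<in>B. g c = (if c = b then 1 else 0 :: real))"
    using linear_independent_extend[OF assms, of "\<lambda>c. if c = b then 1 else 0"] .
  then have "linear (coord B b) \<and> (\<forall>c\<in>B. coord B b c = (if c = b then 1 else 0))"
    unfolding coord_def by (rule someI_ex)
  then show "linear (coord B b)" and "\<And>c. c \<in> B \<Longrightarrow> coord B b c = (if c = b then 1 else 0)"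
    by auto
qed

lemma coord_sum:
  assumes "independent B" "finite B" "b \<in> B"
  shows "coord B b (\<Sum>c\<in>B. u c *\<^sub>R c) = u b"
proof -
  have "coord B b (\<Sum>c\<in>B. u c *\<^sub>R c) = (\<Sum>c\<in>B. u c * coord B b c)"
    using coord_props(1)[OF assms(1)] by (simp add: linear_sum linear_cmul)
  also have "\<dots> = (\<Sum>c\<in>B. if c = b then u c else 0)"
    using coord_props(2)[OF assms(1)] by (intro sum.cong) auto
  finally show ?thesis using assms by simp
qed

lemma sum_coord:
  assumes "independent B" "finite B" "z \<in> span B"
  shows "(\<Sum>b\<in>B. coord B b z *\<^sub>R b) = z"
proof -
  obtain u where u: "z = (\<Sum>b\<in>B. u b *\<^sub>R b)"
    using assms(3) unfolding span_finite[OF assms(2)] by auto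
  show ?thesis
    using coord_sum[OF assms(1,2), of _ u] unfolding u by (intro sum.cong) auto
qed

definition coneof :: "'a::real_vector set \<Rightarrow> 'a set" where
  "coneof B = {\<Sum>b\<in>B. u b *\<^sub>R b |u. \<forall>b\<in>B. 0 \<le> u b}"

lemma coneof_iff:
  assumes "independent B" "finite B"
  shows "z \<in> coneof B \<longleftrightarrow> z \<in> span B \<and> (\<forall>b\<in>B. 0 \<le> coord B b z)"
proof
  assume "z \<in> coneof B"
  then obtain u where u: "z = (\<Sum>b\<in>B. u b *\<^sub>R b)" "\<forall>b\<in>B. 0 \<le> u b"
    unfolding coneof_def by auto
  then show "z \<in> span B \<and> (\<forall>b\<in>B. 0 \<le> coord B b z)"
    using coord_sum[OF assms] by (auto intro!: span_sum span_scale intro: span_base)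
next
  assume "z \<in> span B \<and> (\<forall>b\<in>B. 0 \<le> coord B b z)"
  then show "z \<in> coneof B"
    unfolding coneof_def using sum_coord[OF assms, of z] by (auto intro!: exI[of _ "\<lambda>b. coord B b z"])
qed

section \<open>Small perturbations and generic points\<close>

lemma eventually_affine_pos:
  fixes g :: "'a::real_vector \<Rightarrow> real"
  assumes "linear g" "0 < g z"
  shows "\<forall>\<^sub>F \<epsilon> in at_right (0::real). 0 < g (z + \<epsilon> *\<^sub>R w)"
proof -
  have "((\<lambda>\<epsilon>. g z + \<epsilon> * g w) \<longlongrightarrow> g z + 0 * g w) (at_right 0)"
    by (intro tendsto_intros)
  then have "\<forall>\<^sub>F \<epsilon> in at_right 0. 0 < g z + \<epsilon> * g w"
    using assms(2) by (intro order_tendstoD(1)) auto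
  then show ?thesis
    by (simp add: linear_add[OF assms(1)] linear_cmul[OF assms(1)])
qed

lemma eventually_affine_nonzero:
  fixes g :: "'a::real_vector \<Rightarrow> real"
  assumes "linear g" "g z \<noteq> 0 \<or> g w \<noteq> 0"
  shows "\<forall>\<^sub>F \<epsilon> in at_right (0::real). g (z + \<epsilon> *\<^sub>R w) \<noteq> 0"
proof (cases "g z = 0")
  case True
  have "\<forall>\<^sub>F \<epsilon> in at_right (0::real). 0 < \<epsilon>"
    by (simp add: eventually_at_right_less)
  then show ?thesis
    by eventually_elim (use True assms in \<open>auto simp: linear_add linear_cmul\<close>)
next
  case False
  have "((\<lambda>\<epsilon>. g z + \<epsilon> * g w) \<longlongrightarrow> g z + 0 * g w) (at_right 0)"
    by (intro tendsto_intros)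
  then have "\<forall>\<^sub>F \<epsilon> in at_right 0. g z + \<epsilon> * g w \<noteq> 0"
    using False by (intro tendsto_imp_eventually_ne) auto
  then show ?thesis
    by (simp add: linear_add[OF assms(1)] linear_cmul[OF assms(1)])
qed

text \<open>Scaling is by strictly positive factors only, so that open cones, which need not contain
  the origin, qualify.\<close>

definition pos_closed :: "'a::real_vector set \<Rightarrow> bool" where
  "pos_closed Q \<longleftrightarrow> (\<forall>x\<in>Q. \<forall>y\<in>Q. x + y \<in> Q) \<and> (\<forall>x\<in>Q. \<forall>r>0. r *\<^sub>R x \<in> Q)"

text \<open>A linear functional that is nonzero somewhere on the span of \<open>Q\<close> is nonzero
  at some \<open>q\<close> in \<open>Q\<close>. Moving a point that already avoids the other zero
  sets by a small positive multiple of \<open>q\<close> avoids this one too and spoils none.\<close>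

lemma exists_generic_point:
  fixes Q :: "'a::real_vector set" and G :: "('a \<Rightarrow> real) set"
  assumes Q: "pos_closed Q" "Q \<noteq> {}" and "finite G"
    and lin: "\<And>g. g \<in> G \<Longrightarrow> linear g"
    and nz: "\<And>g. g \<in> G \<Longrightarrow> \<exists>v \<in> span Q. g v \<noteq> 0"
  shows "\<exists>w\<in>Q. \<forall>g\<in>G. g w \<noteq> 0"
  using \<open>finite G\<close> lin nz
proof (induction G)
  case empty
  then show ?case using Q by auto
next
  case (insert g G)
  then obtain w where w: "w \<in> Q" "\<forall>h\<in>G. h w \<noteq> 0" by auto
  have lg: "linear g" by (rule insert.prems(1)) simp
  obtain q where q: "q \<in> Q" "g q \<noteq> 0"
  proof (rule ccontr)
    assume "\<not> thesis"
    with that have 0: "\<And>q. q \<in> Q \<Longrightarrow> g q = 0" by auto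
    obtain v where "v \<in> span Q" "g v \<noteq> 0" using insert.prems(2)[of g] by auto
    then show False using linear_eq_0_on_span[OF lg 0] by auto
  qed
  have "\<forall>\<^sub>F \<epsilon> in at_right (0::real). \<forall>h\<in>insert g G. h (w + \<epsilon> *\<^sub>R q) \<noteq> 0"
    using insert.hyps(1) w q insert.prems(1) by (intro eventually_ball_finite ballI eventually_affine_nonzero) auto
  moreover have "\<forall>\<^sub>F \<epsilon> in at_right (0::real). 0 < \<epsilon>"
    by (simp add: eventually_at_right_less)
  ultimately have "\<forall>\<^sub>F \<epsilon> in at_right (0::real). 0 < \<epsilon> \<and> (\<forall>h\<in>insert g G. h (w + \<epsilon> *\<^sub>R q) \<noteq> 0)"
    by eventually_elim auto
  then obtain \<epsilon> :: real where "0 < \<epsilon>" "\<forall>h\<in>insert g G. h (w + \<epsilon> *\<^sub>R q) \<noteq> 0"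
    using eventually_happens'[OF trivial_limit_at_right_real] by blast
  moreover from this have "w + \<epsilon> *\<^sub>R q \<in> Q"
    using Q w q by (auto simp: pos_closed_def)
  ultimately show ?case by blast
qed

text \<open>The abstract setting of the covering argument: simplicial cones of full dimension in
  \<open>L\<close>, and a convex cone \<open>Q\<close> to be covered. \<open>overlap\<close> makes
  the cones meet along common faces; \<open>pivot\<close> says that a facet of a cone either misses
  \<open>Q\<close> or has a further cone of the family attached to it.\<close>

locale cone_family =
  fixes L :: "'a::real_vector set" and BB :: "'a set set" and Q :: "'a set"
  assumes finite_family: "finite BB"
    and basis: "\<And>B. B \<in> BB \<Longrightarrow> independent B \<and> finite B \<and> span B = L"
    and Q_closed: "pos_closed Q" and Q_subset: "Q \<subseteq> L" and Q_spans: "L \<subseteq> span Q"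
    and overlap: "\<And>B B' z b. \<lbrakk>B \<in> BB; B' \<in> BB; z \<in> coneof B; z \<in> coneof B'; b \<in> B; 0 < coord B b z\<rbrakk>
        \<Longrightarrow> b \<in> B'"
    and pivot: "\<And>B b. \<lbrakk>B \<in> BB; b \<in> B\<rbrakk> \<Longrightarrow>
        (\<forall>z\<in>Q. 0 < coord B b z) \<or> (\<exists>f. f \<noteq> b \<and> insert f (B - {b}) \<in> BB)"
    and sum_basis_in_Q: "\<And>B. B \<in> BB \<Longrightarrow> \<Sum>B \<in> Q"
begin

lemma linear_coord: "B \<in> BB \<Longrightarrow> linear (coord B b)"
  using basis coord_props(1) by blast

lemma coord_basis: "B \<in> BB \<Longrightarrow> c \<in> B \<Longrightarrow> coord B b c = (if c = b then 1 else 0)"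
  using basis coord_props(2) by blast

lemma mem_cone: "B \<in> BB \<Longrightarrow> z \<in> coneof B \<longleftrightarrow> z \<in> L \<and> (\<forall>b\<in>B. 0 \<le> coord B b z)"
  using basis coneof_iff by blast

text \<open>Exchanging \<open>b\<close> for \<open>f\<close> has to lead across the facet opposite
  \<open>b\<close>: two cones on the same side of a common facet would share more than
  \<open>overlap\<close> allows.\<close>

lemma pivot_sign:
  assumes B: "B \<in> BB" "b \<in> B" and f: "f \<noteq> b" "insert f (B - {b}) \<in> BB"
  shows "coord B b f < 0" "f \<notin> B"
proof -
  let ?B' = "insert f (B - {b})"
  have iB: "independent B" "finite B" "span B = L" using basis[OF B(1)] by auto
  have nb: "b \<notin> span (B - {b})" using iB(1) B(2) by (metis dependent_def)
  have bL: "b \<in> span ?B'" using basis[OF f(2)] iB B(2) by (metis span_base)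
  show fB: "f \<notin> B"
  proof
    assume "f \<in> B"
    with f(1) have "?B' = B - {b}" by auto
    with nb bL show False by simp
  qed
  show "coord B b f < 0"
  proof (rule ccontr)
    assume neg: "\<not> coord B b f < 0"
    txt \<open>Otherwise \<open>f\<close> plus a large multiple of the shared vectors lies in both cones, yet uses \<open>f\<close>.\<close>
    define M where "M = (\<Sum>c\<in>B. \<bar>coord B c f\<bar>)"
    have M: "\<bar>coord B c f\<bar> \<le> M" if "c \<in> B" for c
      unfolding M_def using that iB(2) by (intro member_le_sum) auto
    have M0: "0 \<le> M" unfolding M_def by (intro sum_nonneg) auto
    define z where "z = f + (\<Sum>c\<in>B-{b}. M *\<^sub>R c)"
    have z': "z = (\<Sum>c\<in>?B'. (if c = f then 1 else M) *\<^sub>R c)"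
    proof -
      have "(\<Sum>c\<in>B-{b}. M *\<^sub>R c) = (\<Sum>c\<in>B-{b}. (if c = f then 1 else M) *\<^sub>R c)"
        using fB by (intro sum.cong) auto
      then show ?thesis unfolding z_def using fB iB(2) by (subst sum.insert) auto
    qed
    have c': "z \<in> coneof ?B'"
      unfolding coneof_def z' using M0
      by (intro CollectI exI[of _ "\<lambda>c. if c = f then 1 else M"] conjI refl) auto
    have fL: "f \<in> L" using basis[OF f(2)] by (metis insertI1 span_base)
    have co: "coord B c z = coord B c f + (if c = b then 0 else M)" if c: "c \<in> B" for c
    proof -
      have "coord B c z = coord B c f + (\<Sum>d\<in>B-{b}. M * coord B c d)"
        unfolding z_def using linear_coord[OF B(1)] by (simp add: linear_add linear_sum linear_cmul)
      also have "(\<Sum>d\<in>B-{b}. M * coord B c d) = (\<Sum>d\<in>B-{b}. if d = c then M else 0)"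
        using coord_basis[OF B(1)] by (intro sum.cong) auto
      also have "\<dots> = (if c = b then 0 else M)"
        using c iB(2) by auto
      finally show ?thesis .
    qed
    have "z \<in> L" using c' mem_cone[OF f(2)] by simp
    then have c: "z \<in> coneof B"
      using co M neg by (fastforce simp: mem_cone[OF B(1)] abs_le_iff)
    have "coord ?B' f z = 1"
      unfolding z' using basis[OF f(2)] by (subst coord_sum) auto
    then have "f \<in> B"
      using overlap[OF f(2) B(1) c' c, of f] by simp
    with fB show False by simp
  qed
qed

section \<open>Covering along a segment\<close>

lemma linear_segment:
  fixes g :: "'a \<Rightarrow> real"
  assumes "linear g" shows "g ((1 - \<tau>) *\<^sub>R y + \<tau> *\<^sub>R z) = (1 - \<tau>) * g y + \<tau> * g z"
  using assms by (simp add: linear_add linear_cmul)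

lemma eventually_segment_pos:
  fixes g :: "'a \<Rightarrow> real"
  assumes "linear g" "0 < g ((1 - \<tau>) *\<^sub>R y + \<tau> *\<^sub>R z)"
  shows "\<forall>\<^sub>F \<mu> in nhds \<tau>. 0 < g ((1 - \<mu>) *\<^sub>R y + \<mu> *\<^sub>R z)"
proof -
  have "((\<lambda>\<mu>. (1 - \<mu>) * g y + \<mu> * g z) \<longlongrightarrow> (1 - \<tau>) * g y + \<tau> * g z) (nhds \<tau>)"
    by (intro tendsto_intros filterlim_ident)
  then show ?thesis
    using assms(2) unfolding linear_segment[OF assms(1)] by (rule order_tendstoD(1))
qed

lemma segment_in_L: "y \<in> L \<Longrightarrow> z \<in> L \<Longrightarrow> BB \<noteq> {} \<Longrightarrow> a *\<^sub>R y + b *\<^sub>R z \<in> L"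
  using basis by (metis all_not_in_conv span_add span_scale)

text \<open>By genericity at most one coordinate vanishes at the point. If none does, nearby points
  of the line stay in the cone of \<open>B\<close>. If the one at \<open>b\<close> does, nearby
  points with nonnegative \<open>b\<close>-coordinate are still in this cone, and the others lie in
  the cone across the facet.\<close>

lemma local_cover:
  assumes B: "B \<in> BB" and yz: "y \<in> L" "z \<in> L"
    and p: "(1 - \<tau>) *\<^sub>R y + \<tau> *\<^sub>R z \<in> Q" and pB: "(1 - \<tau>) *\<^sub>R y + \<tau> *\<^sub>R z \<in> coneof B"
    and gen: "\<And>b c. \<lbrakk>b \<in> B; c \<in> B; b \<noteq> c\<rbrakk> \<Longrightarrow> coord B b (((1 - \<tau>) *\<^sub>R y + \<tau> *\<^sub>R z)) \<noteq> 0 \<or> coord B c (((1 - \<tau>) *\<^sub>R y + \<tau> *\<^sub>R z)) \<noteq> 0"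
  shows "\<forall>\<^sub>F \<mu> in nhds \<tau>. (1 - \<mu>) *\<^sub>R y + \<mu> *\<^sub>R z \<in> \<Union>(coneof ` BB)"
proof -
  let ?p = "\<lambda>\<mu>. (1 - \<mu>) *\<^sub>R y + \<mu> *\<^sub>R z"
  have iB: "independent B" "finite B" "span B = L" using basis[OF B] by auto
  have pL: "?p \<mu> \<in> L" for \<mu> using segment_in_L yz B by blast
  have nn: "0 \<le> coord B b (?p \<tau>)" if "b \<in> B" for b
    using pB that by (simp add: mem_cone[OF B])
  show ?thesis
  proof (cases "\<exists>b\<in>B. coord B b (?p \<tau>) = 0")
    case False
    then have pos: "0 < coord B b (?p \<tau>)" if "b \<in> B" for b
      using nn[OF that] that by force
    have "\<forall>\<^sub>F \<mu> in nhds \<tau>. \<forall>b\<in>B. 0 < coord B b (?p \<mu>)"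
      using iB(2) pos by (intro eventually_ball_finite ballI eventually_segment_pos linear_coord B) auto
    then show ?thesis
    proof eventually_elim
      case (elim \<mu>)
      then have "?p \<mu> \<in> coneof B" using pL by (auto simp: mem_cone[OF B] less_imp_le)
      then show ?case using B by blast
    qed
  next
    case True
    then obtain b where b: "b \<in> B" "coord B b (?p \<tau>) = 0" by blast
    have pos: "0 < coord B c (?p \<tau>)" if "c \<in> B - {b}" for c
      using nn[of c] gen[of b c] b that by force
    obtain f where f: "f \<noteq> b" "insert f (B - {b}) \<in> BB"
      using pivot[OF B b(1)] p b(2) by force
    let ?B' = "insert f (B - {b})"
    have g: "coord B b f < 0" "f \<notin> B" using pivot_sign[OF B b(1) f] by auto
    \<comment> \<open>\<open>?h c\<close> is the coordinate at \<open>c\<close> after the exchange,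
      found by eliminating \<open>b\<close> in favour of \<open>f\<close>. Where the
      \<open>b\<close>-coordinate vanishes it agrees with the old one, so it is positive at the
      point and hence nearby.\<close>
    let ?h = "\<lambda>c q. coord B c q - coord B b q * (coord B c f / coord B b f)"
    have lh: "linear (?h c)" for c
      using linear_coord[OF B] by (intro linearI) (simp_all add: linear_add linear_cmul algebra_simps add_divide_distrib)
    have "\<forall>\<^sub>F \<mu> in nhds \<tau>. \<forall>c\<in>B-{b}. 0 < coord B c (?p \<mu>)"
      using iB(2) pos by (intro eventually_ball_finite ballI eventually_segment_pos linear_coord B) auto
    moreover have "\<forall>\<^sub>F \<mu> in nhds \<tau>. \<forall>c\<in>B-{b}. 0 < ?h c (?p \<mu>)"
      using iB(2) pos b(2) by (intro eventually_ball_finite ballI eventually_segment_pos lh) auto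
    ultimately show ?thesis
    proof eventually_elim
      case (elim \<mu>)
      let ?q = "?p \<mu>"
      show ?case
      proof (cases "0 \<le> coord B b ?q")
        case True
        then have "?q \<in> coneof B"
          using elim(1) pL[of \<mu>] unfolding mem_cone[OF B] by (metis Diff_iff less_imp_le singletonD)
        then show ?thesis using B by blast
      next
        case False
        have fL: "f \<in> span B" using basis[OF f(2)] iB(3) by (metis insertI1 span_base)
        have f_eq: "f = coord B b f *\<^sub>R b + (\<Sum>c\<in>B-{b}. coord B c f *\<^sub>R c)"
          using sum_coord[OF iB(1,2) fL] sum.remove[OF iB(2) b(1), of "\<lambda>c. coord B c f *\<^sub>R c"] by simp
        have q_eq: "?q = coord B b ?q *\<^sub>R b + (\<Sum>c\<in>B-{b}. coord B c ?q *\<^sub>R c)"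
          using sum_coord[OF iB(1,2), of ?q] pL[of \<mu>] iB(3)
            sum.remove[OF iB(2) b(1), of "\<lambda>c. coord B c ?q *\<^sub>R c"] by simp
        \<comment> \<open>The coordinate at \<open>f\<close> in the exchanged basis, here a quotient
          of two negative numbers.\<close>
        define r where "r = coord B b ?q / coord B b f"
        have r0: "0 \<le> r" unfolding r_def using g(1) False by (auto simp: divide_nonpos_neg)
        define u where "u c = (if c = f then r else ?h c ?q)" for c
        have "(\<Sum>c\<in>?B'. u c *\<^sub>R c) = r *\<^sub>R f + (\<Sum>c\<in>B-{b}. u c *\<^sub>R c)"
          using g(2) iB(2) by (subst sum.insert) (auto simp: u_def)
        also have "(\<Sum>c\<in>B-{b}. u c *\<^sub>R c) = (\<Sum>c\<in>B-{b}. (coord B c ?q - r * coord B c f) *\<^sub>R c)"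
          using g(2) by (intro sum.cong) (auto simp: u_def r_def)
        also have "\<dots> = (\<Sum>c\<in>B-{b}. coord B c ?q *\<^sub>R c) - r *\<^sub>R (\<Sum>c\<in>B-{b}. coord B c f *\<^sub>R c)"
          by (simp add: scaleR_diff_left sum_subtractf scaleR_sum_right)
        also have "(\<Sum>c\<in>B-{b}. coord B c ?q *\<^sub>R c) = ?q - coord B b ?q *\<^sub>R b"
          by (subst eq_diff_eq, subst add.commute, rule q_eq[symmetric])
        also have "(\<Sum>c\<in>B-{b}. coord B c f *\<^sub>R c) = f - coord B b f *\<^sub>R b"
          by (subst eq_diff_eq, subst add.commute, rule f_eq[symmetric])
        also have "r *\<^sub>R f + (?q - coord B b ?q *\<^sub>R b - r *\<^sub>R (f - coord B b f *\<^sub>R b)) = ?q"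
          using g(1) by (simp add: r_def scaleR_diff_right)
        finally have eq: "?q = (\<Sum>c\<in>?B'. u c *\<^sub>R c)" by simp
        have "\<forall>c\<in>?B'. 0 \<le> u c"
          using r0 elim(2) by (auto simp: u_def less_imp_le)
        then have "?q \<in> coneof ?B'" unfolding coneof_def using eq by blast
        then show ?thesis using f(2) by blast
      qed
    qed
  qed
qed

text \<open>If \<open>b\<close> and \<open>c\<close> both vanished at a common point of the segment, the determinant in the
  hypothesis would be zero.\<close>

lemma segment_cover:
  assumes yz: "y \<in> Q" "z \<in> Q" and B0: "B0 \<in> BB" "y \<in> coneof B0"
    and gen: "\<And>B b c. \<lbrakk>B \<in> BB; b \<in> B; c \<in> B; b \<noteq> c\<rbrakk> \<Longrightarrow>
      coord B b y * coord B c z - coord B c y * coord B b z \<noteq> 0"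
  shows "z \<in> \<Union>(coneof ` BB)"
proof -
  let ?p = "\<lambda>\<mu>. (1 - \<mu>) *\<^sub>R y + \<mu> *\<^sub>R z"
  let ?U = "\<Union>(coneof ` BB)"
  have yzL: "y \<in> L" "z \<in> L" using yz Q_subset by auto
  have pL: "?p \<mu> \<in> L" for \<mu> using segment_in_L yzL B0 by blast
  have pQ: "?p \<mu> \<in> Q" if "\<mu> \<in> {0..1}" for \<mu>
  proof (cases "\<mu> = 0 \<or> \<mu> = 1")
    case True then show ?thesis using yz by auto
  next
    case False
    with that have "0 < \<mu>" "0 < 1 - \<mu>" by auto
    then show ?thesis using Q_closed yz unfolding pos_closed_def by blast
  qed
  \<comment> \<open>The argument is connectedness of \<open>{0..1}\<close>: the set of parameters
    with covered points is closed, as there are finitely many cones, and by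
    \<open>local_cover\<close> each covered parameter of the interval is interior to it.\<close>
  have "closed {\<mu>. ?p \<mu> \<in> coneof B}" if B: "B \<in> BB" for B
  proof -
    have "{\<mu>. ?p \<mu> \<in> coneof B} = (\<Inter>b\<in>B. {\<mu>. 0 \<le> (1 - \<mu>) * coord B b y + \<mu> * coord B b z})"
      using pL linear_segment[OF linear_coord[OF B]] by (auto simp: mem_cone[OF B])
    also have "closed \<dots>"
      by (intro closed_INT ballI closed_Collect_le continuous_intros)
    finally show ?thesis .
  qed
  then have "closed (\<Union>B\<in>BB. {\<mu>. ?p \<mu> \<in> coneof B})"
    using finite_family by blast
  moreover have "(\<Union>B\<in>BB. {\<mu>. ?p \<mu> \<in> coneof B}) = {\<mu>. ?p \<mu> \<in> ?U}" by auto
  ultimately have cl: "open (- {\<mu>. ?p \<mu> \<in> ?U})" by (simp add: open_Compl)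
  have loc: "\<tau> \<in> interior {\<mu>. ?p \<mu> \<in> ?U}" if l: "\<tau> \<in> {0..1}" "?p \<tau> \<in> ?U" for \<tau>
  proof -
    obtain B where B: "B \<in> BB" "?p \<tau> \<in> coneof B" using l by blast
    have "\<forall>\<^sub>F \<mu> in nhds \<tau>. ?p \<mu> \<in> ?U"
    proof (rule local_cover[OF B(1) yzL pQ[OF l(1)] B(2)])
      fix b c assume bc: "b \<in> B" "c \<in> B" "b \<noteq> c"
      show "coord B b (?p \<tau>) \<noteq> 0 \<or> coord B c (?p \<tau>) \<noteq> 0"
      proof (rule ccontr)
        assume "\<not> ?thesis"
        then have e: "(1 - \<tau>) * coord B b y + \<tau> * coord B b z = 0" 
          "(1 - \<tau>) * coord B c y + \<tau> * coord B c z = 0"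
          using linear_segment[OF linear_coord[OF B(1)]] by auto
        let ?D = "coord B b y * coord B c z - coord B c y * coord B b z"
        have "\<tau> * ?D = coord B b y * ((1 - \<tau>) * coord B c y + \<tau> * coord B c z)
          - coord B c y * ((1 - \<tau>) * coord B b y + \<tau> * coord B b z)" by algebra
        moreover have "(1 - \<tau>) * ?D = coord B c z * ((1 - \<tau>) * coord B b y + \<tau> * coord B b z)
          - coord B b z * ((1 - \<tau>) * coord B c y + \<tau> * coord B c z)" by algebra
        ultimately have "\<tau> * ?D = 0" "(1 - \<tau>) * ?D = 0" unfolding e by auto
        then show False using gen[OF B(1) bc] by auto
      qed
    qed
    then obtain S where "open S" "\<tau> \<in> S" "\<And>\<mu>. \<mu> \<in> S \<Longrightarrow> ?p \<mu> \<in> ?U"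
      unfolding eventually_nhds by blast
    then show ?thesis by (intro interiorI[of S]) auto
  qed
  have "0 \<in> interior {\<mu>. ?p \<mu> \<in> ?U} \<inter> {0..1}"
    using loc[of 0] B0 by auto
  moreover have "connected {0..1::real}" by simp
  moreover have "{0..1} \<subseteq> interior {\<mu>. ?p \<mu> \<in> ?U} \<union> - {\<mu>. ?p \<mu> \<in> ?U}"
    using loc by blast
  moreover have "interior {\<mu>. ?p \<mu> \<in> ?U} \<inter> - {\<mu>. ?p \<mu> \<in> ?U} \<inter> {0..1} = {}"
    using interior_subset by blast
  ultimately have "- {\<mu>. ?p \<mu> \<in> ?U} \<inter> {0..1} = {}"
    using connectedD[OF _ open_interior cl, of "{0..1}" "{\<mu>. ?p \<mu> \<in> ?U}"] by blast
  moreover have "1 \<in> {0..1::real}" by simp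
  ultimately have "1 \<in> {\<mu>. ?p \<mu> \<in> ?U}" by blast
  then show ?thesis by simp
qed

text \<open>The hypothesis on \<open>z0\<close> admits boundary points of \<open>Q\<close>. Both
  ends of the segment are generic: the start lies inside one cone, the target at a small distance
  from \<open>z0\<close> in the direction \<open>w2\<close>. Letting the target tend to
  \<open>z0\<close> suffices, as a finite union of these cones is closed.\<close>

theorem cover:
  assumes "BB \<noteq> {}" and z0: "z0 \<in> L" "\<And>w. w \<in> Q \<Longrightarrow> z0 + w \<in> Q"
  shows "z0 \<in> \<Union>(coneof ` BB)"
proof -
  obtain B0 where B0: "B0 \<in> BB" using assms(1) by blast
  let ?G = "(\<lambda>(B, b). coord B b) ` (SIGMA B:BB. B)"
  have finG: "finite (SIGMA B:BB. B)" using finite_family basis by blast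
  have Qne: "Q \<noteq> {}" using sum_basis_in_Q[OF B0] by blast
  have bQ: "b \<in> span Q" if "B \<in> BB" "b \<in> B" for B b
    using Q_spans basis[OF that(1)] span_base[OF that(2)] by blast
  have "\<exists>w\<in>Q. \<forall>g\<in>?G. g w \<noteq> 0"
  proof (rule exists_generic_point[OF Q_closed Qne])
    show "finite ?G" using finG by blast
    show "linear g" if "g \<in> ?G" for g using that linear_coord by auto
    show "\<exists>v\<in>span Q. g v \<noteq> 0" if "g \<in> ?G" for g
    proof -
      obtain B b where B: "B \<in> BB" "b \<in> B" "g = coord B b" using \<open>g \<in> ?G\<close> by auto
      then have "g b = 1" by (simp add: coord_basis)
      then show ?thesis using bQ[OF B(1,2)] by force
    qed
  qed
  then obtain w where w: "w \<in> Q" "\<And>B b. B \<in> BB \<Longrightarrow> b \<in> B \<Longrightarrow> coord B b w \<noteq> 0" by force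
  \<comment> \<open>All coordinates of \<open>\<Sum>B0\<close> with respect to \<open>B0\<close> are
    1, so a small step along \<open>w\<close> stays inside this cone while making the coordinates
    for every cone nonzero.\<close>
  have iB0: "independent B0" "finite B0" "span B0 = L" using basis[OF B0] by auto
  have "\<forall>\<^sub>F \<epsilon> in at_right (0::real). \<forall>(B, b) \<in> (SIGMA B:BB. B). coord B b (\<Sum>B0 + \<epsilon> *\<^sub>R w) \<noteq> 0"
    using w linear_coord by (intro eventually_ball_finite finG) (auto intro!: eventually_affine_nonzero)
  moreover have "\<forall>\<^sub>F \<epsilon> in at_right (0::real). \<forall>b \<in> B0. 0 < coord B0 b (\<Sum>B0 + \<epsilon> *\<^sub>R w)"
    using iB0 coord_sum[OF iB0(1,2), of _ "\<lambda>_. 1"]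
    by (intro eventually_ball_finite ballI eventually_affine_pos linear_coord B0) auto
  moreover have "\<forall>\<^sub>F \<epsilon> in at_right (0::real). 0 < \<epsilon>"
    by (simp add: eventually_at_right_less)
  ultimately have "\<forall>\<^sub>F \<epsilon> in at_right (0::real). 0 < \<epsilon> \<and> (\<forall>b \<in> B0. 0 < coord B0 b (\<Sum>B0 + \<epsilon> *\<^sub>R w))
      \<and> (\<forall>(B, b) \<in> (SIGMA B:BB. B). coord B b (\<Sum>B0 + \<epsilon> *\<^sub>R w) \<noteq> 0)"
    by eventually_elim auto
  then obtain \<epsilon> :: real where e: "0 < \<epsilon>" "\<forall>b \<in> B0. 0 < coord B0 b (\<Sum>B0 + \<epsilon> *\<^sub>R w)"
     "\<forall>(B, b) \<in> (SIGMA B:BB. B). coord B b (\<Sum>B0 + \<epsilon> *\<^sub>R w) \<noteq> 0"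
    using eventually_happens'[OF trivial_limit_at_right_real] by blast
  define y where "y = \<Sum>B0 + \<epsilon> *\<^sub>R w"
  have yQ: "y \<in> Q" unfolding y_def
    using Q_closed e(1) w(1) sum_basis_in_Q[OF B0] by (auto simp: pos_closed_def)
  have yB: "y \<in> coneof B0"
    using e(2) yQ Q_subset by (auto simp: mem_cone[OF B0] y_def less_imp_le)
  have ynz: "coord B b y \<noteq> 0" if "B \<in> BB" "b \<in> B" for B b
    using e(3) that by (auto simp: y_def)
  \<comment> \<open>With \<open>y\<close> fixed, the determinant of \<open>segment_cover\<close> is
    linear in the target. At the basis vector \<open>c\<close> its value is
    \<open>coord B b y\<close>, which is nonzero, so generic targets avoid its zeros.\<close>
  define D where "D = (\<lambda>(B, b, c) z. coord B b y * coord B c z - coord B c y * coord B b z)"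
  define I where "I = {(B, b, c). B \<in> BB \<and> b \<in> B \<and> c \<in> B \<and> b \<noteq> c}"
  have finI: "finite I"
  proof (rule finite_subset)
    show "I \<subseteq> (SIGMA B:BB. B \<times> B)" by (auto simp: I_def)
    show "finite (SIGMA B:BB. B \<times> B)" using finite_family basis by blast
  qed
  have linD: "linear (D i)" if "i \<in> I" for i
    using that linear_coord unfolding I_def D_def
    by (auto intro!: linearI simp: linear_add linear_cmul algebra_simps)
  have "\<exists>w\<in>Q. \<forall>g\<in>D ` I. g w \<noteq> 0"
  proof (rule exists_generic_point[OF Q_closed Qne])
    show "finite (D ` I)" using finI by blast
    show "linear g" if "g \<in> D ` I" for g using that linD by auto
    show "\<exists>v\<in>span Q. g v \<noteq> 0" if "g \<in> D ` I" for g
    proof -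
      obtain B b c where B: "B \<in> BB" "b \<in> B" "c \<in> B" "b \<noteq> c" "g = D (B, b, c)"
        using \<open>g \<in> D ` I\<close> by (auto simp: I_def)
      then have "g c = coord B b y" by (simp add: D_def coord_basis)
      then show ?thesis using bQ[OF B(1,3)] ynz[OF B(1,2)] by metis
    qed
  qed
  then obtain w2 where w2: "w2 \<in> Q" "\<And>i. i \<in> I \<Longrightarrow> D i w2 \<noteq> 0" by auto
  have "\<forall>\<^sub>F \<epsilon> in at_right (0::real). \<forall>i\<in>I. D i (z0 + \<epsilon> *\<^sub>R w2) \<noteq> 0"
    using w2 linD finI by (intro eventually_ball_finite ballI eventually_affine_nonzero) auto
  moreover have "\<forall>\<^sub>F \<epsilon> in at_right (0::real). 0 < \<epsilon>"
    by (simp add: eventually_at_right_less)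
  ultimately have ev: "\<forall>\<^sub>F \<epsilon> in at_right (0::real). z0 + \<epsilon> *\<^sub>R w2 \<in> \<Union>(coneof ` BB)"
  proof eventually_elim
    case (elim \<epsilon>)
    have "z0 + \<epsilon> *\<^sub>R w2 \<in> Q"
      using elim(2) z0 w2(1) Q_closed by (auto simp: pos_closed_def)
    then show ?case
      using elim(1) by (intro segment_cover[OF yQ _ B0 yB]) (auto simp: I_def D_def)
  qed
  show ?thesis
  proof (rule ccontr)
    assume "z0 \<notin> \<Union>(coneof ` BB)"
    then have "\<exists>b\<in>B. coord B b z0 < 0" if "B \<in> BB" for B
      using that z0(1) mem_cone[OF that] by force
    then have "\<forall>\<^sub>F \<epsilon> in at_right (0::real). z0 + \<epsilon> *\<^sub>R w2 \<notin> coneof B" if B: "B \<in> BB" for B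
    proof -
      obtain b where b: "b \<in> B" "coord B b z0 < 0" using B \<open>\<And>B. B \<in> BB \<Longrightarrow> _\<close> by blast
      have "\<forall>\<^sub>F \<epsilon> in at_right (0::real). 0 < - coord B b (z0 + \<epsilon> *\<^sub>R w2)"
        using b linear_coord[OF B] by (intro eventually_affine_pos linear_compose_neg) auto
      then show ?thesis
        by eventually_elim (use b in \<open>force simp: mem_cone[OF B]\<close>)
    qed
    then have "\<forall>\<^sub>F \<epsilon> in at_right (0::real). \<forall>B\<in>BB. z0 + \<epsilon> *\<^sub>R w2 \<notin> coneof B"
      using finite_family by (intro eventually_ball_finite) auto
    with ev have "\<forall>\<^sub>F \<epsilon> in at_right (0::real). False"
      by eventually_elim auto
    then show False by simp
  qed
qed

end

section \<open>Edges as points\<close>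

definition vvec :: "'n::finite + 'd::finite \<Rightarrow> (real ^ 'n) \<times> (real ^ 'd)" where
  "vvec = case_sum (\<lambda>i. (axis i 1, 0)) (\<lambda>j. (0, axis j 1))"

definition epoint :: "('n::finite + 'd::finite) set \<Rightarrow> (real ^ 'n) \<times> (real ^ 'd)" where
  "epoint e = (\<Sum>x\<in>e. vvec x)"

lemma vvec_inner: "vvec x \<bullet> vvec y = (if x = y then 1 else 0)"
  by (cases x; cases y) (auto simp: vvec_def inner_prod_def inner_axis_axis)

lemma inner_vvec_Inl [simp]: "z \<bullet> vvec (Inl i) = fst z $ i"
  and inner_vvec_Inr [simp]: "z \<bullet> vvec (Inr j) = snd z $ j"
  by (auto simp: vvec_def inner_prod_def inner_axis)

lemma epoint_inner: "epoint e \<bullet> vvec x = (if x \<in> e then 1 else 0)"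
  by (simp add: epoint_def inner_sum_left vvec_inner)

lemma inj_epoint: "inj epoint"
proof (rule injI)
  fix e e' :: "('a + 'b) set" assume "epoint e = epoint e'"
  then have "(x \<in> e) = (x \<in> e')" for x
    using epoint_inner[of e x] epoint_inner[of e' x] by (metis zero_neq_one)
  then show "e = e'" by auto
qed

lemma epoint_edge: "epoint {Inl i, Inr j} = (axis i 1, axis j 1)"
  by (simp add: epoint_def vvec_def)

lemma K_edges_cases:
  assumes "e \<in> K_edges" obtains i j where "e = {Inl i, Inr j}"
  using assms by (auto simp: K_edges_def)

lemma edge_in_K_edges: "isl x \<noteq> isl y \<Longrightarrow> {x, y} \<in> K_edges"
  by (cases x; cases y) (auto simp: K_edges_def insert_commute)

lemma K_edges_isl: "{x, y} \<in> K_edges \<Longrightarrow> isl x \<noteq> isl y"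
  by (auto simp: K_edges_def doubleton_eq_iff)

lemma subgraph_points_eq: "t \<subseteq> K_edges \<Longrightarrow> subgraph_points t = epoint ` t"
  by (fastforce simp: subgraph_points_def epoint_edge[symmetric] K_edges_def image_iff)

lemma finite_epoint_image: "finite (epoint ` t)"
  by simp

lemma sum_epoint_inner:
  "(\<Sum>e\<in>E. c e *\<^sub>R epoint e) \<bullet> vvec x = (\<Sum>e | e \<in> E \<and> x \<in> e. c e)"
  by (simp add: inner_sum_left epoint_inner sum.If_cases if_distrib Int_def cong: if_cong)

section \<open>Alternating circuits\<close>

lemma alternating_circuit:
  fixes c :: "('n::finite + 'd::finite) set \<Rightarrow> real"
  assumes zero: "(\<Sum>e\<in>K_edges. c e *\<^sub>R epoint e) = 0" and e0: "e0 \<in> K_edges" "c e0 \<noteq> 0"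
  obtains w where "is_circuit K_edges w" "even (length w)"
    "\<And>k. k < length w \<Longrightarrow> if even k then 0 < c (circuit_edge w k) else c (circuit_edge w k) < 0"
proof -
  define S where "S = {x. \<exists>e\<in>K_edges. x \<in> e \<and> c e \<noteq> 0}"
  \<comment> \<open>Left vertices will be left along positive edges and right vertices along
    negative ones. As an edge changes sides, each vertex is then left with the sign opposite to that
    of entry.\<close>
  define sg where "sg x = (if isl x then 1 else - 1 :: real)" for x :: "'n + 'd"
  have "\<exists>y\<in>S. {x, y} \<in> K_edges \<and> 0 < sg x * c {x, y}" if x: "x \<in> S" for x
  proof -
    let ?E = "{e \<in> K_edges. x \<in> e}"
    have z: "(\<Sum>e\<in>?E. sg x * c e) = 0"
      using sum_epoint_inner[of c K_edges x] by (simp add: zero sum_distrib_left[symmetric])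
    have "\<exists>e\<in>?E. 0 < sg x * c e"
    proof (rule ccontr)
      assume "\<not> ?thesis"
      then have "\<forall>e\<in>?E. 0 \<le> - (sg x * c e)" by force
      moreover have "(\<Sum>e\<in>?E. - (sg x * c e)) = 0" using z by (simp add: sum_negf)
      ultimately have "\<forall>e\<in>?E. - (sg x * c e) = 0" by (subst (asm) sum_nonneg_eq_0_iff) auto
      moreover obtain e where "e \<in> ?E" "c e \<noteq> 0" using x unfolding S_def by blast
      moreover have "sg x \<noteq> 0" by (simp add: sg_def)
      ultimately show False by (metis mult_eq_0_iff neg_equal_0_iff_equal)
    qed
    then obtain e where e: "e \<in> K_edges" "x \<in> e" "0 < sg x * c e" by blast
    then obtain y where y: "e = {x, y}"
      by (auto elim!: K_edges_cases simp: insert_commute)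
    have "y \<in> e" "c e \<noteq> 0" using e(3) y by auto
    then have "y \<in> S" unfolding S_def using e(1) by blast
    then show ?thesis using e y by blast
  qed
  then obtain nx where nx: "\<And>x. x \<in> S \<Longrightarrow> nx x \<in> S \<and> {x, nx x} \<in> K_edges \<and> 0 < sg x * c {x, nx x}"
    by metis
  have pS: "(nx ^^ k) x \<in> S" if "x \<in> S" for k x
    using that nx by (induction k) auto
  have side: "isl ((nx ^^ k) x) = (isl x = even k)" if "x \<in> S" for k x
  proof (induction k)
    case (Suc k)
    have "isl ((nx ^^ k) x) \<noteq> isl (nx ((nx ^^ k) x))"
      using nx[OF pS[OF that]] by (intro K_edges_isl) auto
    with Suc show ?case by auto
  qed simp
  txt \<open>A shortest period of \<open>nx\<close> at a left vertex yields a simple cycle that starts with a positive edge.\<close>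
  define P where "P p \<longleftrightarrow> 0 < p \<and> (\<exists>y\<in>S. isl y \<and> (nx ^^ p) y = y)" for p
  \<comment> \<open>A repetition in an orbit of \<open>nx\<close> is a period. If it occurs at a
    right vertex, one step further gives the same period at a left one.\<close>
  have PI: "P (b - a)" if "x \<in> S" "a < b" "(nx ^^ a) x = (nx ^^ b) x" for x a b
  proof -
    define u where "u = (nx ^^ a) x"
    have u: "u \<in> S" unfolding u_def using that pS by blast
    have per: "(nx ^^ (b - a)) u = u"
      unfolding u_def using that by (metis comp_apply funpow_add le_add_diff_inverse2 less_imp_le)
    show ?thesis
    proof (cases "isl u")
      case True then show ?thesis using u per that by (auto simp: P_def)
    next
      case False
      have "(nx ^^ (b - a)) (nx u) = nx u" using per by (metis funpow_swap1)
      moreover have "isl (nx u)" using side[OF u, of 1] False by simp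
      ultimately show ?thesis using nx[OF u] that by (auto simp: P_def)
    qed
  qed
  have "\<exists>p. P p"
  proof -
    obtain i j where "e0 = {Inl i, Inr j}" using e0(1) by (rule K_edges_cases)
    then have "Inl i \<in> e0" by simp
    then obtain x where x: "x \<in> S" unfolding S_def using e0 by blast
    have "\<not> inj (\<lambda>k::nat. (nx ^^ k) x)"
      using finite_imageD[of "\<lambda>k::nat. (nx ^^ k) x" UNIV] by auto
    then obtain a b where "a < b" "(nx ^^ a) x = (nx ^^ b) x"
      unfolding inj_def by (metis linorder_neqE_nat)
    then show ?thesis using PI x by blast
  qed
  define p where "p = (LEAST p. P p)"
  have "P p" unfolding p_def using \<open>\<exists>p. P p\<close> by (rule LeastI_ex)
  then obtain y where y: "0 < p" "y \<in> S" "isl y" "(nx ^^ p) y = y" by (auto simp: P_def)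
  have ev: "even p" using side[OF y(2), of p] y by simp
  have inj: "inj_on (\<lambda>k. (nx ^^ k) y) {0..<p}"
  proof (rule linorder_inj_onI')
    fix a b assume ab: "a \<in> {0..<p}" "b \<in> {0..<p}" "a < b"
    show "(nx ^^ a) y \<noteq> (nx ^^ b) y"
    proof
      assume "(nx ^^ a) y = (nx ^^ b) y"
      then have "P (b - a)" using PI y(2) ab(3) by blast
      moreover have "b - a < p" using ab by auto
      ultimately show False unfolding p_def using not_less_Least by blast
    qed
  qed
  \<comment> \<open>Period 2 would traverse one edge in both directions, making its weight positive
    and negative at once.\<close>
  have "p \<noteq> 2"
  proof
    assume p2: "p = 2"
    then have "nx (nx y) = y" using y(4) by (simp add: eval_nat_numeral)
    moreover have "0 < sg y * c {y, nx y}" "0 < sg (nx y) * c {nx y, nx (nx y)}"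
      using nx y(2) by auto
    moreover have "\<not> isl (nx y)" using side[OF y(2), of 1] y(3) by simp
    ultimately show False using y(3) by (simp add: sg_def insert_commute)
  qed
  with ev y(1) have p3: "3 \<le> p" by presburger
  define w where "w = map (\<lambda>k. (nx ^^ k) y) [0..<p]"
  have len: "length w = p" by (simp add: w_def)
  have edge: "circuit_edge w k = {(nx ^^ k) y, nx ((nx ^^ k) y)}" if "k < p" for k
  proof -
    have "w ! (Suc k mod p) = (nx ^^ Suc k) y"
    proof (cases "Suc k = p")
      case True
      then have "w ! (Suc k mod p) = y" using y(1) by (simp add: w_def)
      then show ?thesis using True y(4) by simp
    next
      case False then show ?thesis using that by (simp add: w_def)
    qed
    then show ?thesis using that by (simp add: circuit_edge_def len) (simp add: w_def)
  qed
  have "is_circuit K_edges w"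
    unfolding is_circuit_def using p3 inj edge nx[OF pS[OF y(2)]] len by (auto simp: w_def distinct_map)
  moreover have "if even k then 0 < c (circuit_edge w k) else c (circuit_edge w k) < 0"
    if "k < length w" for k
  proof -
    have "0 < sg ((nx ^^ k) y) * c (circuit_edge w k)"
      using nx[OF pS[OF y(2)], of k] edge[of k] that len by simp
    then show ?thesis using side[OF y(2), of k] y(3) by (simp add: sg_def split: if_splits)
  qed
  ultimately show thesis using that ev len by blast
qed

text \<open>The difference of the two weightings, extended by zero, is a linear relation. Because
  both are nonnegative, its positive edges belong to \<open>s\<close> and its negative ones to
  \<open>t\<close>, so the circuit of \<open>alternating_circuit\<close> alternates between the two
  graphs.\<close>

lemma flow_unique:
  fixes s t :: "('n::finite + 'd::finite) set set"
  assumes st: "s \<subseteq> K_edges" "t \<subseteq> K_edges"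
    and no_alt: "\<not> (\<exists>w. is_circuit K_edges w \<and> alternates s t w)"
    and nonneg: "\<And>e. e \<in> s \<Longrightarrow> 0 \<le> a e" "\<And>e. e \<in> t \<Longrightarrow> 0 \<le> b e"
    and eq: "(\<Sum>e\<in>s. a e *\<^sub>R epoint e) = (\<Sum>e\<in>t. b e *\<^sub>R epoint e)"
  shows "(if e \<in> s then a e else 0) = (if e \<in> t then b e else 0)"
proof (rule ccontr)
  assume ne: "\<not> ?thesis"
  define c where "c e = (if e \<in> s then a e else 0) - (if e \<in> t then b e else 0)" for e
  have "(\<Sum>e\<in>K_edges. (if e \<in> r then f e else 0) *\<^sub>R epoint e) = (\<Sum>e\<in>r. f e *\<^sub>R epoint e)"
    if "r \<subseteq> K_edges" for r :: "('n + 'd) set set" and f :: "_ \<Rightarrow> real"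
    using that by (intro sum.mono_neutral_cong_right) auto
  then have "(\<Sum>e\<in>K_edges. c e *\<^sub>R epoint e) = 0"
    using st eq by (simp add: c_def scaleR_diff_left sum_subtractf)
  moreover have "e \<in> K_edges" using ne st by (auto split: if_splits)
  moreover have "c e \<noteq> 0" using ne by (auto simp: c_def)
  ultimately obtain w where w: "is_circuit K_edges w" "even (length w)"
    "\<And>k. k < length w \<Longrightarrow> if even k then 0 < c (circuit_edge w k) else c (circuit_edge w k) < 0"
    using alternating_circuit by blast
  have "circuit_edge w k \<in> (if even k then s else t)" if "k < length w" for k
    using w(3)[OF that] nonneg[of "circuit_edge w k"] by (auto simp: c_def split: if_splits)
  then have "alternates s t w" using w(2) by (simp add: alternates_def)
  with w(1) no_alt show False by blast
qed

section \<open>Spanning trees\<close>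

lemma acyclic_imp_independent:
  assumes t: "t \<subseteq> K_edges" and acyclic: "\<not> (\<exists>w. is_circuit t w)"
  shows "independent (epoint ` t)"
proof
  assume "dependent (epoint ` t)"
  then obtain u e where u: "(\<Sum>v\<in>epoint ` t. u v *\<^sub>R v) = 0" "e \<in> t" "u (epoint e) \<noteq> 0"
    by (auto simp: dependent_finite)
  define c where "c e = (if e \<in> t then u (epoint e) else 0)" for e
  have "(\<Sum>e\<in>K_edges. c e *\<^sub>R epoint e) = (\<Sum>e\<in>t. u (epoint e) *\<^sub>R epoint e)"
    using t by (intro sum.mono_neutral_cong_right) (auto simp: c_def)
  also have "\<dots> = 0"
    using u(1) sum.reindex[OF inj_on_subset[OF inj_epoint subset_UNIV, of t], of "\<lambda>v. u v *\<^sub>R v"] by simp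
  finally have "(\<Sum>e\<in>K_edges. c e *\<^sub>R epoint e) = 0" .
  moreover have "e \<in> K_edges" "c e \<noteq> 0" using u t by (auto simp: c_def)
  ultimately obtain w where w: "is_circuit K_edges w"
    "\<And>k. k < length w \<Longrightarrow> if even k then 0 < c (circuit_edge w k) else c (circuit_edge w k) < 0"
    using alternating_circuit by blast
  have "circuit_edge w k \<in> t" if "k < length w" for k
    using w(2)[OF that] by (auto simp: c_def split: if_splits)
  then have "is_circuit t w" using w(1) by (auto simp: is_circuit_def)
  with acyclic show False by blast
qed

text \<open>Flipping the basis vectors of the right side turns each edge point, up to sign, into a
  difference of two vectors; such differences telescope along paths.\<close>

definition vsign :: "'n + 'd \<Rightarrow> real" where
  "vsign x = (if isl x then 1 else - 1)"

text \<open>By telescoping along a path, the difference of the signed basis vectors of any two graph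
  vertices lies in the span. For a left and a right vertex this difference is the point of the edge
  joining them, whether or not that edge is in \<open>t\<close>.\<close>

lemma connected_imp_spanning:
  fixes t :: "('n::finite + 'd::finite) set set"
  assumes t: "t \<subseteq> K_edges" and conn: "graph_connected UNIV t"
  shows "span (epoint ` t) = span (epoint ` K_edges)"
proof
  show "span (epoint ` t) \<subseteq> span (epoint ` K_edges)"
    using t by (intro span_mono) auto
  have step: "vsign x *\<^sub>R vvec x - vsign y *\<^sub>R vvec y \<in> span (epoint ` t)" if "{x, y} \<in> t" for x y
  proof -
    have "isl x \<noteq> isl y" using that t by (intro K_edges_isl) auto
    moreover from this have "x \<noteq> y" by blast
    ultimately have "epoint {x, y} = vvec x + vvec y" and "vsign y = - vsign x"
      by (auto simp: vsign_def epoint_def)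
    then have "vsign x *\<^sub>R vvec x - vsign y *\<^sub>R vvec y = vsign x *\<^sub>R epoint {x, y}"
      by (simp add: algebra_simps)
    then show ?thesis using that by (auto intro!: span_scale intro: span_base)
  qed
  have path: "vsign x *\<^sub>R vvec x - vsign y *\<^sub>R vvec y \<in> span (epoint ` t)" for x y
  proof -
    have "(x, y) \<in> {(u, v). {u, v} \<in> t}\<^sup>*"
      using conn by (auto simp: graph_connected_def)
    then show ?thesis
    proof (induction rule: rtrancl_induct)
      case (step y z)
      then have "(vsign x *\<^sub>R vvec x - vsign y *\<^sub>R vvec y) + (vsign y *\<^sub>R vvec y - vsign z *\<^sub>R vvec z)
          \<in> span (epoint ` t)"
        using \<open>\<And>x y. {x, y} \<in> t \<Longrightarrow> _\<close> by (intro span_add) auto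
      then show ?case by simp
    qed (simp add: span_zero)
  qed
  have "epoint e \<in> span (epoint ` t)" if "e \<in> K_edges" for e
  proof -
    obtain i j where "e = {Inl i, Inr j}" using \<open>e \<in> K_edges\<close> by (rule K_edges_cases)
    then show ?thesis
      using path[of "Inl i" "Inr j"] by (simp add: vsign_def epoint_def)
  qed
  then show "span (epoint ` K_edges) \<subseteq> span (epoint ` t)"
    by (intro span_minimal) auto
qed

lemma connected_vertex_covered:
  fixes t :: "('n::finite + 'd::finite) set set"
  assumes conn: "graph_connected UNIV t"
  shows "\<exists>e\<in>t. x \<in> e"
proof -
  obtain y where y: "y \<noteq> x"
    by (cases x) (metis Inl_Inr_False, metis Inr_not_Inl)
  have "(x, y) \<in> {(u, v). {u, v} \<in> t}\<^sup>*"
    using conn by (auto simp: graph_connected_def)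
  then show ?thesis using y by (cases rule: converse_rtranclE) auto
qed

section \<open>The product of simplices\<close>

lemma std_simplex_eq: "std_simplex = {x. (\<forall>i. 0 \<le> x $ i) \<and> (\<Sum>i\<in>UNIV. x $ i) = 1}"
proof
  have "convex {x :: real ^ 'a. (\<forall>i. 0 \<le> x $ i) \<and> (\<Sum>i\<in>UNIV. x $ i) = 1}"
    by (auto simp: convex_def sum.distrib sum_distrib_left[symmetric])
  then show "std_simplex \<subseteq> {x :: real ^ 'a. (\<forall>i. 0 \<le> x $ i) \<and> (\<Sum>i\<in>UNIV. x $ i) = 1}"
    unfolding std_simplex_def by (intro hull_minimal) (auto simp: axis_def)
  show "{x :: real ^ 'a. (\<forall>i. 0 \<le> x $ i) \<and> (\<Sum>i\<in>UNIV. x $ i) = 1} \<subseteq> std_simplex"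
  proof
    fix x :: "real ^ 'a" assume x: "x \<in> {x. (\<forall>i. 0 \<le> x $ i) \<and> (\<Sum>i\<in>UNIV. x $ i) = 1}"
    have "(\<Sum>i\<in>UNIV. x $ i *\<^sub>R (axis i 1 :: real ^ 'a)) \<in> convex hull (range (\<lambda>i. axis i 1))"
      using x by (intro convex_sum) (auto intro: hull_inc)
    then show "x \<in> std_simplex"
      using basis_expansion[of x] by (simp add: std_simplex_def scalar_mult_eq_scaleR)
  qed
qed

lemma mem_simplex_product:
  "z \<in> simplex_product \<longleftrightarrow> (\<forall>x. 0 \<le> z \<bullet> vvec x) \<and> (\<Sum>i\<in>UNIV. fst z $ i) = 1 \<and> (\<Sum>j\<in>UNIV. snd z $ j) = 1"
proof -
  have "(\<forall>x. 0 \<le> z \<bullet> vvec x) \<longleftrightarrow> (\<forall>i. 0 \<le> fst z $ i) \<and> (\<forall>j. 0 \<le> snd z $ j)"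
    by (metis inner_vvec_Inl inner_vvec_Inr obj_sumE)
  then show ?thesis
    by (cases z) (auto simp: simplex_product_def std_simplex_eq)
qed

lemma epoint_image_K_edges: "epoint ` K_edges = range (\<lambda>i. axis i 1) \<times> range (\<lambda>j. axis j 1)"
proof
  show "epoint ` K_edges \<subseteq> range (\<lambda>i. axis i 1) \<times> range (\<lambda>j. axis j 1)"
    by (auto simp: K_edges_def epoint_edge)
  have "(axis i 1, axis j 1) \<in> epoint ` K_edges" for i :: 'a and j :: 'b
    unfolding epoint_edge[symmetric] by (auto simp: K_edges_def)
  then show "range (\<lambda>i. axis i 1) \<times> range (\<lambda>j. axis j 1) \<subseteq> epoint ` (K_edges :: ('a + 'b) set set)"
    by auto
qed

lemma simplex_product_hull: "simplex_product = convex hull (epoint ` K_edges)"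
  by (simp add: simplex_product_def std_simplex_def convex_hull_Times epoint_image_K_edges)

text \<open>The inner product of two edge points counts common endpoints: 2 for a point with itself,
  at most 1 otherwise. So a half-space contains all other edge points but not
  \<open>a\<close>.\<close>

lemma vertex_set_simplex_product: "vertex_set simplex_product = epoint ` K_edges"
proof -
  have "a \<notin> convex hull (epoint ` K_edges - {a})" if "a \<in> epoint ` K_edges"
    for a :: "(real ^ 'a) \<times> (real ^ 'b)"
  proof -
    obtain e where e: "e \<in> K_edges" "a = epoint e" using \<open>a \<in> epoint ` K_edges\<close> by blast
    then obtain i j where ij: "a = (axis i 1, axis j 1)"
      using K_edges_cases epoint_edge by metis
    have "epoint ` K_edges - {a} \<subseteq> {z. a \<bullet> z \<le> 1}"
      by (auto simp: ij K_edges_def epoint_edge inner_prod_def inner_axis_axis split: if_splits)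
    then have "convex hull (epoint ` K_edges - {a}) \<subseteq> {z. a \<bullet> z \<le> 1}"
      by (intro hull_minimal convex_halfspace_le)
    moreover have "a \<bullet> a = 2"
      by (simp add: ij inner_prod_def inner_axis_axis)
    ultimately show ?thesis by auto
  qed
  then show ?thesis
    unfolding vertex_set_def simplex_product_hull
    by (subst extreme_point_of_convex_hull_convex_independent) (auto intro: finite_imp_compact)
qed

text \<open>A height function: only the left coordinates are summed, so that every edge point gets
  height 1. The coefficients of a combination of edge points then sum to its height, which makes
  cone coordinates of points of the product barycentric.\<close>

definition lsum :: "(real ^ 'n::finite) \<times> (real ^ 'd::finite) \<Rightarrow> real" where
  "lsum z = (\<Sum>i\<in>UNIV. fst z $ i)"

lemma linear_lsum: "linear lsum"
  by (auto intro!: linearI simp: lsum_def sum.distrib sum_distrib_left)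

lemma lsum_epoint: "e \<in> K_edges \<Longrightarrow> lsum (epoint e) = 1"
  by (auto simp: K_edges_def epoint_edge lsum_def axis_def)

text \<open>Isolating \<open>p i\<close> writes the combination as a point strictly between
  \<open>p i\<close> and the weighted mean of the other points, unless these coincide; a face
  containing an inner point of a segment contains its ends.\<close>

lemma face_contains_combination_points:
  fixes S :: "'a::real_normed_vector set"
  assumes F: "F face_of S" and "convex S" and "finite I"
    and u: "\<And>i. i \<in> I \<Longrightarrow> 0 < u i" "sum u I = 1" and p: "\<And>i. i \<in> I \<Longrightarrow> p i \<in> S"
    and z: "(\<Sum>i\<in>I. u i *\<^sub>R p i) \<in> F" and i: "i \<in> I"
  shows "p i \<in> F"
proof (cases "I = {i}")
  case True
  then show ?thesis using z u by simp
next
  case False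
  define r where "r = sum u (I - {i})"
  have ri: "u i + r = 1" using u(2) sum.remove[OF \<open>finite I\<close> i, of u] by (simp add: r_def)
  have r0: "0 < r" unfolding r_def using False i u(1) \<open>finite I\<close> by (intro sum_pos) auto
  define q where "q = (\<Sum>j\<in>I-{i}. (u j / r) *\<^sub>R p j)"
  have q: "q \<in> S" unfolding q_def
    using \<open>finite I\<close> u(1) p r0 \<open>convex S\<close>
    by (intro convex_sum) (auto simp: sum_divide_distrib[symmetric] r_def less_imp_le)
  have z_eq: "(\<Sum>i\<in>I. u i *\<^sub>R p i) = (1 - r) *\<^sub>R p i + r *\<^sub>R q"
    using sum.remove[OF \<open>finite I\<close> i, of "\<lambda>i. u i *\<^sub>R p i"] r0 ri
    by (simp add: q_def scaleR_sum_right eq_diff_eq[symmetric])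
  show ?thesis
  proof (cases "p i = q")
    case True
    then show ?thesis using z z_eq by (simp add: scaleR_left_distrib[symmetric])
  next
    case False
    moreover have "r < 1" using ri u(1)[OF i] by simp
    ultimately have "(1 - r) *\<^sub>R p i + r *\<^sub>R q \<in> open_segment (p i) q"
      using r0 unfolding in_segment by blast
    then show ?thesis using F p[OF i] q z z_eq by (auto simp: face_of_def)
  qed
qed

section \<open>Circuits in the bipartite graph\<close>

lemma circuit_side:
  assumes w: "is_circuit K_edges w" and k: "k < length w"
  shows "isl (w ! k) = (isl (w ! 0) = even k)"
  using k
proof (induction k)
  case (Suc k)
  have "circuit_edge w k \<in> K_edges" using w Suc.prems by (auto simp: is_circuit_def)
  then have "isl (w ! k) \<noteq> isl (w ! Suc k)"
    using Suc.prems by (intro K_edges_isl) (auto simp: circuit_edge_def)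
  then show ?case using Suc by auto
qed simp

lemma circuit_even:
  assumes w: "is_circuit K_edges w"
  shows "even (length w)"
proof -
  have len: "3 \<le> length w" using w by (simp add: is_circuit_def)
  then have "circuit_edge w (length w - 1) \<in> K_edges" using w by (auto simp: is_circuit_def)
  moreover have "Suc (length w - 1) = length w" using len by simp
  ultimately have "isl (w ! (length w - 1)) \<noteq> isl (w ! 0)"
    by (intro K_edges_isl) (simp only: circuit_edge_def mod_self)
  then have "odd (length w - 1)" using circuit_side[OF w, of "length w - 1"] len by force
  then show ?thesis using len by auto
qed

text \<open>Equal edges at different positions would make each position the cyclic successor of the
  other, which forces length 2.\<close>

lemma circuit_edge_inj:
  assumes w: "is_circuit t w" and kl: "k < length w" "l < length w"
    and eq: "circuit_edge w k = circuit_edge w l"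
  shows "k = l"
proof (rule ccontr)
  assume ne: "k \<noteq> l"
  let ?n = "length w"
  have w': "3 \<le> ?n" "distinct w" using w by (auto simp: is_circuit_def)
  have m: "Suc k mod ?n < ?n" "Suc l mod ?n < ?n"
    using kl by (metis gr_implies_not0 mod_less_divisor not_gr_zero)+
  have "k = Suc l mod ?n" "l = Suc k mod ?n"
    using eq ne kl m w'(2) unfolding circuit_edge_def doubleton_eq_iff
    by (auto simp: nth_eq_iff_index_eq)
  moreover have "Suc i mod ?n = (if Suc i = ?n then 0 else Suc i)" if "i < ?n" for i
    using that by simp
  ultimately show False using kl w'(1) by (auto split: if_splits)
qed

text \<open>Each vertex of the circuit is an end of exactly one even-numbered and one odd-numbered
  edge, so both sums equal the sum of the basis vectors of its vertices.\<close>

lemma circuit_even_odd_sums: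
  fixes w :: "('n::finite + 'd::finite) list"
  assumes w: "is_circuit K_edges w" and m: "length w = 2 * m"
  shows "(\<Sum>j<m. epoint (circuit_edge w (2 * j))) = (\<Sum>j<m. epoint (circuit_edge w (Suc (2 * j))))"
proof -
  let ?f = "\<lambda>k. vvec (w ! (k mod (2 * m)))"
  have ep: "epoint (circuit_edge w k) = ?f k + ?f (Suc k)" if "k < 2 * m" for k
  proof -
    have "circuit_edge w k \<in> K_edges" using w that m by (auto simp: is_circuit_def)
    then have "isl (w ! k) \<noteq> isl (w ! (Suc k mod (2 * m)))"
      using m by (intro K_edges_isl) (auto simp: circuit_edge_def)
    then have "w ! k \<noteq> w ! (Suc k mod (2 * m))" by metis
    then show ?thesis using that by (simp add: circuit_edge_def epoint_def m)
  qed
  have "(\<Sum>j<m. epoint (circuit_edge w (2 * j))) = (\<Sum>j<m. ?f (2 * j)) + (\<Sum>j<m. ?f (Suc (2 * j)))"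
    by (simp add: ep sum.distrib)
  also have "(\<Sum>j<m. ?f (2 * j)) = (\<Sum>j<m. ?f (Suc (Suc (2 * j))))"
  proof (cases m)
    case (Suc n)
    have "(\<Sum>j<m. ?f (2 * j)) = ?f 0 + (\<Sum>j<n. ?f (2 * Suc j))"
      unfolding Suc by (subst sum.lessThan_Suc_shift) simp
    also have "?f 0 = ?f (2 * m)" by simp
    finally show ?thesis by (simp add: Suc)
  qed simp
  also have "\<dots> + (\<Sum>j<m. ?f (Suc (2 * j))) = (\<Sum>j<m. epoint (circuit_edge w (Suc (2 * j))))"
    by (subst add.commute) (simp add: ep sum.distrib)
  finally show ?thesis .
qed

lemma circuit_hulls_meet_point:
  fixes w :: "('n::finite + 'd::finite) list"
  assumes w: "is_circuit K_edges w"
  obtains z m where "length w = 2 * m" "0 < m"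
    "z = (\<Sum>j<m. (1 / real m) *\<^sub>R epoint (circuit_edge w (2 * j)))"
    "z = (\<Sum>j<m. (1 / real m) *\<^sub>R epoint (circuit_edge w (Suc (2 * j))))"
proof -
  obtain m where m: "length w = 2 * m" using circuit_even[OF w] by blast
  moreover have "0 < m" using m w by (auto simp: is_circuit_def)
  ultimately show ?thesis
    using that circuit_even_odd_sums[OF w m] by (simp add: scaleR_sum_right[symmetric])
qed

section \<open>From triangulations to trees\<close>

text \<open>Disjoint subsets of an affinely independent set have disjoint hulls, whereas the even
  and the odd edges of a circuit have a common centroid.\<close>

lemma affine_independent_imp_acyclic:
  assumes t: "t \<subseteq> K_edges" and indep: "\<not> affine_dependent (epoint ` t)"
  shows "\<not> is_circuit t w"
proof
  assume w: "is_circuit t w"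
  then have wK: "is_circuit K_edges w" using t by (auto simp: is_circuit_def)
  obtain z m where m: "length w = 2 * m" "0 < m"
    and z: "z = (\<Sum>j<m. (1 / real m) *\<^sub>R epoint (circuit_edge w (2 * j)))"
      "z = (\<Sum>j<m. (1 / real m) *\<^sub>R epoint (circuit_edge w (Suc (2 * j))))"
    using circuit_hulls_meet_point[OF wK] .
  let ?E = "(\<lambda>j. circuit_edge w (2 * j)) ` {..<m}" and ?O = "(\<lambda>j. circuit_edge w (Suc (2 * j))) ` {..<m}"
  have "z \<in> convex hull (epoint ` ?E)"
    unfolding z(1) using m(2) by (intro convex_sum) (auto intro: hull_inc)
  moreover have "z \<in> convex hull (epoint ` ?O)"
    unfolding z(2) using m(2) by (intro convex_sum) (auto intro: hull_inc)
  moreover have "epoint ` ?E \<union> epoint ` ?O \<subseteq> epoint ` t"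
    using w m(1) by (auto simp: is_circuit_def)
  then have "\<not> affine_dependent (epoint ` ?E \<union> epoint ` ?O)"
    using affine_independent_subset[OF indep] by blast
  then have "convex hull (epoint ` ?E) \<inter> convex hull (epoint ` ?O)
      = convex hull (epoint ` ?E \<inter> epoint ` ?O)"
    by (rule convex_hull_Int[symmetric])
  moreover have "?E \<inter> ?O = {}"
  proof -
    have False if "j < m" "l < m" "circuit_edge w (2 * j) = circuit_edge w (Suc (2 * l))" for j l
      using circuit_edge_inj[OF w _ _ that(3)] that m(1) by presburger
    then show ?thesis by blast
  qed
  then have "epoint ` ?E \<inter> epoint ` ?O = {}"
    by (simp add: image_Int[OF inj_epoint, symmetric])
  ultimately show False by auto
qed

text \<open>Full dimension gives connectedness: the points of \<open>t\<close> have the affine hull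
  of the whole product, so a linear functional vanishing on them vanishes at every edge point.
  Affine independence gives acyclicity.\<close>

lemma full_simplex_imp_spanning_tree:
  fixes t :: "('n::finite + 'd::finite) set set"
  assumes t: "t \<subseteq> K_edges" and indep: "\<not> affine_dependent (epoint ` t)"
    and full: "aff_dim (epoint ` t) = aff_dim (simplex_product :: ((real ^ 'n) \<times> (real ^ 'd)) set)"
  shows "is_spanning_tree UNIV K_edges t"
proof -
  have "(x, y) \<in> {(u, v). {u, v} \<in> t}\<^sup>*" for x y
  proof (rule ccontr)
    assume nxy: "(x, y) \<notin> {(u, v). {u, v} \<in> t}\<^sup>*"
    define R where "R = {z. (x, z) \<in> {(u, v). {u, v} \<in> t}\<^sup>*}"
    have step: "v \<in> R" if "u \<in> R" "{u, v} \<in> t" for u v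
      using that unfolding R_def by (auto intro: rtrancl_into_rtrancl)
    txt \<open>The signed vertex sum over the component \<open>R\<close> vanishes on \<open>t\<close> but not on an edge leaving \<open>R\<close>.\<close>
    define \<psi> where "\<psi> z = (\<Sum>u\<in>R. vsign u * (z \<bullet> vvec u))" for z :: "(real ^ 'n) \<times> (real ^ 'd)"
    have lin: "linear \<psi>"
      unfolding \<psi>_def by (intro linearI) (auto simp: inner_add_left sum.distrib algebra_simps sum_distrib_left)
    have \<psi>_edge: "\<psi> (epoint {u, v}) = (if u \<in> R then vsign u else 0) + (if v \<in> R then vsign v else 0)"
      if "u \<noteq> v" for u v
    proof -
      have "\<psi> (epoint {u, v}) = (\<Sum>z\<in>R. (if z = u then vsign z else 0) + (if z = v then vsign z else 0))"
        unfolding \<psi>_def using that by (intro sum.cong) (auto simp: epoint_inner)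
      then show ?thesis by (simp add: sum.distrib)
    qed
    have "epoint ` t \<subseteq> {z. \<psi> z = 0}"
    proof
      fix v assume "v \<in> epoint ` t"
      then obtain e where e: "e \<in> t" "v = epoint e" by blast
      then obtain i j where ij: "e = {Inl i, Inr j}" using t K_edges_cases by blast
      have "Inl i \<in> R \<longleftrightarrow> Inr j \<in> R"
        using step[of "Inl i" "Inr j"] step[of "Inr j" "Inl i"] e ij by (auto simp: insert_commute)
      then show "v \<in> {z. \<psi> z = 0}"
        unfolding e(2) ij mem_Collect_eq by (subst \<psi>_edge) (auto simp: vsign_def)
    qed
    then have "affine hull (epoint ` t) \<subseteq> {z. \<psi> z = 0}"
      by (intro hull_minimal subspace_imp_affine)
        (auto simp: subspace_def linear_0[OF lin] linear_add[OF lin] linear_cmul[OF lin])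
    moreover have "affine hull (epoint ` t) = affine hull simplex_product"
    proof -
      have "affine hull (epoint ` t) \<subseteq> affine hull simplex_product"
        using t by (auto simp: simplex_product_hull intro!: hull_mono)
      moreover have "\<not> affine hull (epoint ` t) \<subset> affine hull (simplex_product :: ((real ^ 'n) \<times> (real ^ 'd)) set)"
        using aff_dim_psubset full by (metis less_irrefl)
      ultimately show ?thesis by blast
    qed
    ultimately have zero: "\<psi> (epoint e) = 0" if "e \<in> K_edges" for e
      using that by (auto simp: simplex_product_hull hull_inc)
    have cross: False if "isl u \<noteq> isl v" "u \<in> R" "v \<notin> R" for u v
    proof -
      have "u \<noteq> v" using that by blast
      then show False
        using zero[OF edge_in_K_edges[OF that(1)]] \<psi>_edge[of u v] that by (auto simp: vsign_def split: if_splits)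
    qed
    have xR: "x \<in> R" and yR: "y \<notin> R" using nxy by (auto simp: R_def)
    \<comment> \<open>No edge of the complete bipartite graph can leave \<open>R\<close>. If
      \<open>x\<close> and \<open>y\<close> are on the same side, no edge joins them, and the detour
      through \<open>z\<close> on the other side is used.\<close>
    obtain z :: "'n + 'd" where z: "isl z \<noteq> isl x" by (metis sum.disc(1) sum.disc(2))
    show False
      using cross[OF _ xR yR] cross[OF _ _ yR, of z] cross[OF _ xR, of z] z by metis
  qed
  then have "graph_connected UNIV t" by (simp add: graph_connected_def)
  then show ?thesis
    using t affine_independent_imp_acyclic[OF t indep] by (auto simp: is_spanning_tree_def)
qed

lemma spanning_tree_basis:
  assumes "is_spanning_tree UNIV K_edges t"
  shows "independent (epoint ` t)" "span (epoint ` t) = span (epoint ` K_edges)"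
  using assms acyclic_imp_independent connected_imp_spanning by (auto simp: is_spanning_tree_def)

lemma extreme_in_subset:
  "x extreme_point_of P \<Longrightarrow> x \<in> S \<Longrightarrow> S \<subseteq> P \<Longrightarrow> x extreme_point_of S"
  by (auto simp: extreme_point_of_def)

text \<open>An end of \<open>e\<close> met by no other edge would be a leaf. Consequently the
  barycentre of the facet opposite an internal edge has only positive coordinates.\<close>

lemma internal_edge_removal_covers:
  fixes t :: "('n::finite + 'd::finite) set set"
  assumes conn: "graph_connected UNIV t" and e: "internal_edge t e"
  shows "\<exists>g\<in>t - {e}. x \<in> g"
proof (cases "x \<in> e")
  case True
  show ?thesis
  proof (rule ccontr)
    assume "\<not> ?thesis"
    then have "{g \<in> t. x \<in> g} = {e}" using e True by (auto simp: internal_edge_def)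
    then have "is_leaf t x" by (simp add: is_leaf_def)
    then show False using e True unfolding internal_edge_def by blast
  qed
next
  case False
  then show ?thesis using connected_vertex_covered[OF conn, of x] by auto
qed

section \<open>Simplices of a given triangulation\<close>

context
  fixes \<K> :: "((real ^ 'n::finite) \<times> (real ^ 'd::finite)) set set"
  assumes tri: "triangulates_without_new_vertices \<K> simplex_product"
begin

lemma member_simplex:
  assumes "S \<in> \<K>"
  obtains C where "S = convex hull C" "\<not> affine_dependent C" "vertex_set S = C" "C \<subseteq> epoint ` K_edges"
proof -
  obtain n where "n simplex S"
    using tri assms by (auto simp: triangulates_without_new_vertices_def simplicial_complex_def)
  then obtain C where C: "\<not> affine_dependent C" "S = convex hull C"
    by (auto simp: simplex_def)
  moreover have v: "vertex_set S = C"
    unfolding vertex_set_def C(2) using extreme_point_of_convex_hull_affine_independent[OF C(1)] by blast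
  moreover have "C \<subseteq> vertex_set simplex_product"
    using tri assms v unfolding triangulates_without_new_vertices_def by blast
  then have "C \<subseteq> epoint ` K_edges" by (simp only: vertex_set_simplex_product)
  ultimately show ?thesis using that by blast
qed

lemma vertex_of_polytope_in_member:
  assumes "S \<in> \<K>" "e \<in> K_edges" "epoint e \<in> S"
  shows "epoint e \<in> vertex_set S"
proof -
  have "epoint e extreme_point_of simplex_product"
    using vertex_set_simplex_product assms(2) unfolding vertex_set_def by blast
  moreover have "S \<subseteq> simplex_product"
    using tri assms(1) by (auto simp: triangulates_without_new_vertices_def)
  ultimately show ?thesis
    using extreme_in_subset assms(3) by (auto simp: vertex_set_def)
qed

lemma member_face: "S \<in> \<K> \<Longrightarrow> S' \<in> \<K> \<Longrightarrow> S \<inter> S' face_of S"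
  using tri by (auto simp: triangulates_without_new_vertices_def simplicial_complex_def)

text \<open>The common centroid of the even and the odd edges lies in both simplices. Their
  intersection is a face of the simplex of \<open>t\<close>, so it contains all odd edge points;
  being vertices of the polytope, these are also vertices of the simplex of \<open>s\<close>. The
  whole circuit then lies in \<open>s\<close>.\<close>

lemma no_alternating_circuit_of_members:
  assumes s: "s \<subseteq> K_edges" "convex hull (epoint ` s) \<in> \<K>" "\<not> affine_dependent (epoint ` s)"
    and t: "t \<subseteq> K_edges" "convex hull (epoint ` t) \<in> \<K>"
    and w: "is_circuit K_edges w"
  shows "\<not> alternates s t w"
proof
  assume alt: "alternates s t w"
  obtain z m where m: "length w = 2 * m" "0 < m"
    and z: "z = (\<Sum>j<m. (1 / real m) *\<^sub>R epoint (circuit_edge w (2 * j)))"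
      "z = (\<Sum>j<m. (1 / real m) *\<^sub>R epoint (circuit_edge w (Suc (2 * j))))"
    using circuit_hulls_meet_point[OF w] .
  let ?S = "convex hull (epoint ` s)" and ?T = "convex hull (epoint ` t)"
  have es: "circuit_edge w (2 * j) \<in> s" and ot: "circuit_edge w (Suc (2 * j)) \<in> t" if "j < m" for j
    using alt that m(1) by (auto simp: alternates_def dest: spec[of _ "2 * j"] spec[of _ "Suc (2 * j)"])
  have zS: "z \<in> ?S"
    unfolding z(1) using m(2) es by (intro convex_sum) (auto intro: hull_inc)
  have oT: "epoint (circuit_edge w (Suc (2 * j))) \<in> ?T" if "j < m" for j
    using ot[OF that] by (auto intro: hull_inc)
  have zT: "z \<in> ?T"
    unfolding z(2) using m(2) oT by (intro convex_sum) auto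
  have os: "circuit_edge w (Suc (2 * j)) \<in> s" if "j < m" for j
  proof -
    have "epoint (circuit_edge w (Suc (2 * j))) \<in> ?T \<inter> ?S"
      by (rule face_contains_combination_points[OF member_face[OF t(2) s(2)], where I = "{..<m}" and u = "\<lambda>_. 1 / real m"])
        (use zS zT oT m(2) z(2) that in auto)
    then have "epoint (circuit_edge w (Suc (2 * j))) \<in> vertex_set ?S"
      using ot[OF that] t(1) by (intro vertex_of_polytope_in_member[OF s(2)]) auto
    also have "vertex_set ?S = epoint ` s"
      unfolding vertex_set_def using extreme_point_of_convex_hull_affine_independent[OF s(3)] by blast
    finally show ?thesis by (simp add: inj_image_mem_iff[OF inj_epoint])
  qed
  have "circuit_edge w k \<in> s" if "k < length w" for k
  proof (cases "even k")
    case True then show ?thesis using es that m(1) by (auto elim!: evenE)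
  next
    case False then show ?thesis using os that m(1) by (auto elim!: oddE)
  qed
  then have "is_circuit s w" using w by (auto simp: is_circuit_def)
  then show False using affine_independent_imp_acyclic[OF s(1,3)] by blast
qed

text \<open>The neighbour across the facet contains all vertices of the facet because members meet
  in faces. Counting vertices by dimension leaves room for one more, and the direction of the step
  rules out \<open>epoint e\<close>.\<close>

lemma internal_edge_flip:
  assumes t: "t \<subseteq> K_edges" "convex hull (epoint ` t) \<in> \<K>" "is_spanning_tree UNIV K_edges t"
    and full: "aff_dim (epoint ` t) = aff_dim (simplex_product :: ((real ^ 'n) \<times> (real ^ 'd)) set)"
    and indep: "\<not> affine_dependent (epoint ` t)"
    and e: "internal_edge t e"
  obtains f S' where "f \<in> K_edges" "f \<noteq> e" "S' \<in> \<K>" "vertex_set S' = epoint ` insert f (t - {e})"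
    "aff_dim S' = aff_dim (simplex_product :: ((real ^ 'n) \<times> (real ^ 'd)) set)"
proof -
  let ?P = "simplex_product :: ((real ^ 'n) \<times> (real ^ 'd)) set"
  let ?C = "epoint ` t" and ?b = "epoint e" and ?D = "epoint ` (t - {e})"
  have conn: "graph_connected UNIV t" using t(3) by (simp add: is_spanning_tree_def)
  have et: "e \<in> t" using e by (simp add: internal_edge_def)
  have eK: "?b \<in> ?P" using et t(1) by (auto simp: simplex_product_hull hull_inc)
  have iC: "independent ?C" "finite ?C" using spanning_tree_basis(1)[OF t(3)] by auto
  have D: "?D = ?C - {?b}" using et by (auto simp: inj_image_mem_iff[OF inj_epoint] dest: injD[OF inj_epoint])
  define N where "N = real (card (t - {e}))"
  have ne: "t - {e} \<noteq> {}" using internal_edge_removal_covers[OF conn e] by auto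
  then have N: "0 < N" by (simp add: N_def card_gt_0_iff)
  have "(\<Sum>g\<in>t-{e}. 1 / N) = N * (1 / N)" by (simp only: sum_constant N_def)
  also have "\<dots> = 1" using N by simp
  finally have sum_N: "(\<Sum>g\<in>t-{e}. 1 / N) = 1" .
  define x where "x = (\<Sum>g\<in>t-{e}. (1 / N) *\<^sub>R epoint g)"
  have xS: "x \<in> convex hull ?C"
    unfolding x_def using N sum_N by (intro convex_sum) (auto simp del: sum_constant intro: hull_inc)
  moreover have "convex hull ?C \<subseteq> ?P"
    unfolding simplex_product_hull using t(1) by (intro hull_mono) auto
  ultimately have xP: "x \<in> ?P" by blast
  have xpos: "0 < x \<bullet> vvec u" for u
  proof -
    obtain g where g: "g \<in> t - {e}" "u \<in> g" using internal_edge_removal_covers[OF conn e] by blast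
    have "x \<bullet> vvec u = (\<Sum>g | g \<in> t - {e} \<and> u \<in> g. 1 / N)" unfolding x_def by (rule sum_epoint_inner)
    also have "0 < \<dots>" using g N by (intro sum_pos) auto
    finally show ?thesis .
  qed
  \<comment> \<open>The ray from the barycentre of the facet directly away from
    \<open>epoint e\<close>: in the basis given by \<open>t\<close> its coordinate at
    \<open>epoint e\<close> is \<open>- \<epsilon>\<close>.\<close>
  let ?y = "\<lambda>\<epsilon>::real. x + \<epsilon> *\<^sub>R (x - ?b)"
  have "\<forall>\<^sub>F \<epsilon> in at_right 0. \<forall>u\<in>UNIV. 0 < (\<lambda>z. z \<bullet> vvec u) (?y \<epsilon>)"
    using xpos by (intro eventually_ball_finite ballI eventually_affine_pos bounded_linear.linear[OF bounded_linear_inner_left]) auto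
  then have "\<forall>\<^sub>F \<epsilon> in at_right 0. ?y \<epsilon> \<in> ?P"
  proof eventually_elim
    case (elim \<epsilon>)
    then show ?case
      using xP eK by (auto simp: mem_simplex_product sum.distrib sum_subtractf sum_distrib_left[symmetric] less_imp_le)
  qed
  \<comment> \<open>The members missing \<open>x\<close> are finitely many compact sets, so for
    small \<open>\<epsilon>\<close> the point is outside all of them; the member containing it
    therefore contains \<open>x\<close> too.\<close>
  moreover have "\<forall>\<^sub>F \<epsilon> in at_right 0. \<forall>S'\<in>\<K>. x \<notin> S' \<longrightarrow> ?y \<epsilon> \<notin> S'"
  proof (intro eventually_ball_finite ballI)
    show "finite \<K>" using tri by (auto simp: triangulates_without_new_vertices_def simplicial_complex_def)
    fix S' assume S': "S' \<in> \<K>"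
    show "\<forall>\<^sub>F \<epsilon> in at_right 0. x \<notin> S' \<longrightarrow> ?y \<epsilon> \<notin> S'"
    proof (cases "x \<in> S'")
      case False
      obtain C where "S' = convex hull C" "\<not> affine_dependent C" using member_simplex[OF S'] by metis
      then have "compact S'"
        by (simp add: aff_independent_finite compact_convex_hull finite_imp_compact)
      then have "open (- S')" by (intro open_Compl compact_imp_closed)
      moreover have "(?y \<longlongrightarrow> x + 0 *\<^sub>R (x - ?b)) (at_right 0)" by (intro tendsto_intros)
      ultimately have "\<forall>\<^sub>F \<epsilon> in at_right 0. ?y \<epsilon> \<in> - S'"
        using False by (intro topological_tendstoD) auto
      then show ?thesis by eventually_elim auto
    qed simp
  qed
  moreover have "\<forall>\<^sub>F \<epsilon> in at_right (0::real). 0 < \<epsilon>"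
    by (simp add: eventually_at_right_less)
  ultimately have "\<forall>\<^sub>F \<epsilon> in at_right 0. 0 < \<epsilon> \<and> ?y \<epsilon> \<in> ?P \<and> (\<forall>S'\<in>\<K>. x \<notin> S' \<longrightarrow> ?y \<epsilon> \<notin> S')"
    by eventually_elim blast
  then obtain \<epsilon> where \<epsilon>: "0 < \<epsilon>" "?y \<epsilon> \<in> ?P" "\<forall>S'\<in>\<K>. x \<notin> S' \<longrightarrow> ?y \<epsilon> \<notin> S'"
    using eventually_happens'[OF trivial_limit_at_right_real] by blast
  then obtain S' where S': "S' \<in> \<K>" "?y \<epsilon> \<in> S'" "x \<in> S'"
    using tri unfolding triangulates_without_new_vertices_def by blast
  obtain C' where C': "S' = convex hull C'" "\<not> affine_dependent C'" "vertex_set S' = C'" "C' \<subseteq> epoint ` K_edges"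
    using member_simplex[OF S'(1)] .
  have finC': "finite C'" using C'(2) aff_independent_finite by blast
  have "epoint g \<in> C'" if g: "g \<in> t - {e}" for g
  proof -
    have "epoint g \<in> convex hull ?C \<inter> S'"
      by (rule face_contains_combination_points[OF member_face[OF t(2) S'(1)], where I = "t - {e}" and u = "\<lambda>_. 1 / N"])
        (use S'(3) xS N sum_N g in \<open>auto simp: x_def simp del: sum_constant intro: hull_inc\<close>)
    then show ?thesis using vertex_of_polytope_in_member[OF S'(1), of g] g t(1) C'(3) by auto
  qed
  then have DC': "?D \<subseteq> C'" by (rule image_subsetI)
  have "aff_dim C' \<le> aff_dim ?P"
    using C'(4) by (intro aff_dim_subset) (auto simp: simplex_product_hull hull_inc)
  then have card_le: "card C' \<le> card ?C"
    using full aff_dim_affine_independent[OF C'(2)] aff_dim_affine_independent[OF indep] by simp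
  have linc: "linear (coord ?C ?b)" by (rule coord_props(1)[OF iC(1)])
  have cD: "coord ?C ?b v = 0" if "v \<in> ?D" for v
    using coord_props(2)[OF iC(1), of v ?b] that D by auto
  have "coord ?C ?b x = 0"
    unfolding x_def using linc cD by (simp add: linear_sum linear_cmul)
  moreover have "coord ?C ?b ?b = 1" using coord_props(2)[OF iC(1), of ?b ?b] et by auto
  ultimately have cy: "coord ?C ?b (?y \<epsilon>) = - \<epsilon>"
    using linc by (simp add: linear_add linear_cmul linear_diff)
  \<comment> \<open>With \<open>epoint e\<close> among its vertices the neighbour would be the
    simplex of \<open>t\<close> itself, where the coordinate at \<open>epoint e\<close> is never
    negative.\<close>
  have bC': "?b \<notin> C'"
  proof
    assume "?b \<in> C'"
    moreover have "?C = insert ?b ?D" using et by (metis image_insert insert_Diff)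
    ultimately have "?C \<subseteq> C'" using DC' by simp
    then have "C' = ?C" using card_le finC' by (metis card_seteq)
    then have "?y \<epsilon> \<in> convex hull ?C" using S'(2) C'(1) by simp
    moreover have "convex hull ?C \<subseteq> {v. 0 \<le> coord ?C ?b v}"
    proof (rule hull_minimal)
      show "convex {v. 0 \<le> coord ?C ?b v}"
        using linc by (auto simp: convex_def linear_add linear_cmul)
      show "?C \<subseteq> {v. 0 \<le> coord ?C ?b v}"
      proof
        fix v assume "v \<in> ?C"
        then show "v \<in> {v. 0 \<le> coord ?C ?b v}" by (simp add: coord_props(2)[OF iC(1)])
      qed
    qed
    ultimately show False using cy \<epsilon>(1) by auto
  qed
  \<comment> \<open>On the span of the facet that coordinate is zero, so the neighbour must have a
    further vertex.\<close>
  have "C' \<noteq> ?D"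
  proof
    assume "C' = ?D"
    then have "?y \<epsilon> \<in> span ?D" using S'(2) C'(1) convex_hull_subset_span by blast
    then have "coord ?C ?b (?y \<epsilon>) = 0" using linear_eq_0_on_span[OF linc cD] by blast
    then show False using cy \<epsilon>(1) by simp
  qed
  then obtain v where v: "v \<in> C'" "v \<notin> ?D" using DC' by blast
  have "v \<in> epoint ` K_edges" using C'(4) v(1) by (rule subsetD)
  then obtain f where fv: "v = epoint f" "f \<in> K_edges" by (rule imageE)
  have f: "f \<in> K_edges" "epoint f \<in> C'" "epoint f \<notin> ?D" using v fv by simp_all
  have "?b \<in> ?C" using et by (rule imageI)
  then have "card ?C = Suc (card ?D)" unfolding D by (rule card.remove[OF iC(2)])
  also have "Suc (card ?D) = card (insert (epoint f) ?D)" using f(3) by simp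
  finally have card_C: "card ?C = card (insert (epoint f) ?D)" .
  have C'_eq: "insert (epoint f) ?D = C'"
  proof (rule card_seteq[OF finC'])
    show "insert (epoint f) ?D \<subseteq> C'" using f(2) DC' by (metis insert_subset)
    show "card C' \<le> card (insert (epoint f) ?D)" using card_le unfolding card_C .
  qed
  then have vs: "vertex_set S' = epoint ` insert f (t - {e})" using C'(3) by simp
  have "f \<noteq> e" using f(2) bC' by blast
  have "card C' = card ?C" unfolding card_C C'_eq ..
  then have "aff_dim S' = aff_dim ?P"
    using full aff_dim_affine_independent[OF C'(2)] aff_dim_affine_independent[OF indep]
    by (simp add: C'(1) aff_dim_convex_hull)
  then show thesis by (rule that[OF f(1) \<open>f \<noteq> e\<close> S'(1) vs])
qed

end

section \<open>From trees to triangulations\<close>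

lemma sum_epoint_image: "(\<Sum>v\<in>epoint ` A. f v) = (\<Sum>e\<in>A. f (epoint e))"
  by (simp add: sum.reindex[OF inj_on_subset[OF inj_epoint subset_UNIV]])

lemma hull_epoint_iff:
  "z \<in> convex hull (epoint ` A) \<longleftrightarrow>
    (\<exists>a. (\<forall>e\<in>A. 0 \<le> a e) \<and> sum a A = 1 \<and> z = (\<Sum>e\<in>A. a e *\<^sub>R epoint e))"
proof
  assume "z \<in> convex hull (epoint ` A)"
  then obtain u where "\<forall>v\<in>epoint ` A. 0 \<le> u v" "sum u (epoint ` A) = 1" "(\<Sum>v\<in>epoint ` A. u v *\<^sub>R v) = z"
    unfolding convex_hull_finite[OF finite_epoint_image] by auto
  then show "\<exists>a. (\<forall>e\<in>A. 0 \<le> a e) \<and> sum a A = 1 \<and> z = (\<Sum>e\<in>A. a e *\<^sub>R epoint e)"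
    unfolding sum_epoint_image by (intro exI[of _ "\<lambda>e. u (epoint e)"]) auto
next
  assume "\<exists>a. (\<forall>e\<in>A. 0 \<le> a e) \<and> sum a A = 1 \<and> z = (\<Sum>e\<in>A. a e *\<^sub>R epoint e)"
  then show "z \<in> convex hull (epoint ` A)"
    by (auto intro!: convex_sum intro: hull_inc)
qed

lemma sum_coord_epoint:
  assumes "independent (epoint ` t)" "z \<in> span (epoint ` t)"
  shows "(\<Sum>e\<in>t. coord (epoint ` t) (epoint e) z *\<^sub>R epoint e) = z"
  using sum_coord[OF assms(1) _ assms(2)] by (simp add: sum_epoint_image)

lemma simplex_product_in_span: "simplex_product \<subseteq> span (epoint ` K_edges)"
  unfolding simplex_product_hull by (rule convex_hull_subset_span)

lemma lsum_simplex_product: "z \<in> simplex_product \<Longrightarrow> lsum z = 1"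
  by (simp add: mem_simplex_product lsum_def)

lemma lsum_combination:
  assumes "t \<subseteq> K_edges"
  shows "lsum (\<Sum>v\<in>epoint ` t. u v *\<^sub>R v) = (\<Sum>v\<in>epoint ` t. u v)"
proof -
  have "lsum (\<Sum>v\<in>epoint ` t. u v *\<^sub>R v) = (\<Sum>v\<in>epoint ` t. u v * lsum v)"
    by (simp add: linear_sum[OF linear_lsum] linear_cmul[OF linear_lsum])
  also have "\<dots> = (\<Sum>v\<in>epoint ` t. u v)"
    unfolding sum_epoint_image using assms by (intro sum.cong refl) (simp add: lsum_epoint subset_iff)
  finally show ?thesis .
qed

lemma spanning_tree_affine_independent:
  "is_spanning_tree UNIV K_edges t \<Longrightarrow> \<not> affine_dependent (epoint ` t)"
  using spanning_tree_basis(1) affine_dependent_imp_dependent by blast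

lemma card_epoint_image: "card (epoint ` A) = card A"
  by (simp add: card_image inj_on_subset[OF inj_epoint])

text \<open>Applying \<open>lsum\<close> shows that the coordinates of a point of the product in the
  tree basis sum to 1. So the product lies in the affine hull of the tree's points, whose dimension
  follows from affine independence.\<close>

lemma aff_dim_simplex_product:
  fixes t :: "('n::finite + 'd::finite) set set"
  assumes tree: "is_spanning_tree UNIV K_edges t"
  shows "aff_dim (simplex_product :: ((real ^ 'n) \<times> (real ^ 'd)) set) = int (card t) - 1"
proof -
  let ?P = "simplex_product :: ((real ^ 'n) \<times> (real ^ 'd)) set"
  note B = spanning_tree_basis[OF tree]
  have tK: "t \<subseteq> K_edges" using tree by (simp add: is_spanning_tree_def)
  have "?P \<subseteq> affine hull (epoint ` t)"
  proof
    fix z :: "(real ^ 'n) \<times> (real ^ 'd)" assume z: "z \<in> ?P"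
    let ?c = "\<lambda>v. coord (epoint ` t) v z"
    have zs: "z \<in> span (epoint ` t)" using z simplex_product_in_span B(2) by auto
    have "1 = lsum (\<Sum>v\<in>epoint ` t. ?c v *\<^sub>R v)"
      using sum_coord[OF B(1) _ zs] lsum_simplex_product[OF z] by simp
    also have "\<dots> = (\<Sum>v\<in>epoint ` t. ?c v)" by (rule lsum_combination[OF tK])
    finally show "z \<in> affine hull (epoint ` t)"
      unfolding affine_hull_finite[OF finite_epoint_image] using sum_coord[OF B(1) _ zs] by auto
  qed
  then have "aff_dim ?P \<le> aff_dim (epoint ` t)"
    by (metis aff_dim_affine_hull aff_dim_subset)
  moreover have "aff_dim (epoint ` t) \<le> aff_dim ?P"
    using tK by (intro aff_dim_subset) (auto simp: simplex_product_hull hull_inc)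
  moreover have "aff_dim (epoint ` t) = int (card t) - 1"
    using aff_dim_affine_independent[OF spanning_tree_affine_independent[OF tree]] by (simp add: card_epoint_image)
  ultimately show ?thesis by simp
qed

section \<open>Collections of trees satisfying the three conditions\<close>

context
  fixes T :: "('n::finite + 'd::finite) set set set"
  assumes nonempty: "T \<noteq> {}"
    and tree: "\<And>t. t \<in> T \<Longrightarrow> is_spanning_tree UNIV K_edges t"
    and flip: "\<And>t e. t \<in> T \<Longrightarrow> internal_edge t e \<Longrightarrow> \<exists>f\<in>K_edges. f \<noteq> e \<and> insert f (t - {e}) \<in> T"
    and no_alternating: "\<And>s t w. s \<in> T \<Longrightarrow> t \<in> T \<Longrightarrow> s \<noteq> t \<Longrightarrow> is_circuit K_edges w \<Longrightarrow> \<not> alternates s t w"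
begin

lemma tree_subset: "t \<in> T \<Longrightarrow> t \<subseteq> K_edges"
  using tree by (simp add: is_spanning_tree_def)

lemma no_alternating_circuit:
  assumes "s \<in> T" "t \<in> T"
  shows "\<not> (\<exists>w. is_circuit K_edges w \<and> alternates s t w)"
proof (cases "s = t")
  case True
  have "is_circuit t w" if "is_circuit K_edges w" "alternates t t w" for w
    using that by (auto simp: is_circuit_def alternates_def)
  then show ?thesis using True tree[OF assms(2)] by (auto simp: is_spanning_tree_def)
qed (use assms no_alternating in blast)

text \<open>By \<open>flow_unique\<close> a common point has the same weights in both hulls, so
  these vanish off \<open>A \<inter> B\<close>. A circuit alternating between the subsets would
  alternate between the trees.\<close>

lemma hull_Int_tree_subsets:
  assumes st: "s \<in> T" "t \<in> T" and AB: "A \<subseteq> s" "B \<subseteq> t"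
  shows "convex hull (epoint ` A) \<inter> convex hull (epoint ` B) = convex hull (epoint ` (A \<inter> B))"
proof
  show "convex hull (epoint ` (A \<inter> B)) \<subseteq> convex hull (epoint ` A) \<inter> convex hull (epoint ` B)"
    by (intro Int_greatest hull_mono) auto
  show "convex hull (epoint ` A) \<inter> convex hull (epoint ` B) \<subseteq> convex hull (epoint ` (A \<inter> B))"
  proof
    fix z assume "z \<in> convex hull (epoint ` A) \<inter> convex hull (epoint ` B)"
    then obtain a b where a: "\<forall>e\<in>A. 0 \<le> a e" "sum a A = 1" "z = (\<Sum>e\<in>A. a e *\<^sub>R epoint e)"
      and b: "\<forall>e\<in>B. 0 \<le> b e" "sum b B = 1" "z = (\<Sum>e\<in>B. b e *\<^sub>R epoint e)"
      unfolding Int_iff hull_epoint_iff by blast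
    have AK: "A \<subseteq> K_edges" "B \<subseteq> K_edges" using AB tree_subset st by blast+
    have nc: "\<not> (\<exists>w. is_circuit K_edges w \<and> alternates A B w)"
    proof
      assume "\<exists>w. is_circuit K_edges w \<and> alternates A B w"
      then obtain w where w: "is_circuit K_edges w" "alternates A B w" by blast
      then have "alternates s t w" using AB unfolding alternates_def by (metis subsetD)
      then show False using no_alternating_circuit[OF st] w(1) by blast
    qed
    have eq: "(if e \<in> A then a e else 0) = (if e \<in> B then b e else 0)" for e
      using flow_unique[OF AK nc, of a b e] a b by simp
    have zero: "a e = 0" if "e \<in> A - (A \<inter> B)" for e
      using eq[of e] that by auto
    have "sum a (A \<inter> B) = 1"
      using a(2) zero by (subst sum.mono_neutral_left[of A]) auto
    moreover have "z = (\<Sum>e\<in>A \<inter> B. a e *\<^sub>R epoint e)"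
      unfolding a(3) using zero by (intro sum.mono_neutral_right) auto
    ultimately show "z \<in> convex hull (epoint ` (A \<inter> B))"
      unfolding hull_epoint_iff using a(1) by auto
  qed
qed

text \<open>Here \<open>overlap\<close> is the uniqueness of nonnegative weights. For
  \<open>pivot\<close>, an internal edge has its exchange, while for an edge ending in a leaf the
  opposite facet lies on the boundary of the cone over the product and so misses
  \<open>?Q\<close>.\<close>

lemma tree_cones: "cone_family (span (epoint ` K_edges)) ((\<lambda>t. epoint ` t) ` T)
    {z \<in> span (epoint ` K_edges). \<forall>x. 0 < z \<bullet> vvec x}"
  (is "cone_family ?L ?BB ?Q")
proof
  have basis: "independent (epoint ` t)" "span (epoint ` t) = ?L" if "t \<in> T" for t
    using spanning_tree_basis[OF tree[OF that]] by auto
  show "finite ?BB" by simp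
  show "independent B \<and> finite B \<and> span B = ?L" if "B \<in> ?BB" for B
    using that basis by auto
  show "pos_closed ?Q"
    by (simp add: pos_closed_def inner_add_left add_pos_pos span_add span_scale)
  show "?Q \<subseteq> ?L" by blast
  have sum_Q: "\<Sum>(epoint ` t) \<in> ?Q" if t: "t \<in> T" for t
  proof -
    have "\<Sum>(epoint ` t) = (\<Sum>e\<in>t. 1 *\<^sub>R epoint e)" by (simp add: sum_epoint_image[of "\<lambda>v. v"])
    moreover have "0 < (\<Sum>e\<in>t. 1 *\<^sub>R epoint e) \<bullet> vvec x" for x
    proof -
      have "{e \<in> t. x \<in> e} \<noteq> {}"
        using connected_vertex_covered[of t x] tree[OF t] by (auto simp: is_spanning_tree_def)
      then show ?thesis unfolding sum_epoint_inner by (intro sum_pos) auto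
    qed
    moreover have "\<Sum>(epoint ` t) \<in> ?L"
      using basis(2)[OF t] by (intro span_sum) (metis span_base)
    ultimately show ?thesis by auto
  qed
  then show "\<Sum>B \<in> ?Q" if "B \<in> ?BB" for B using that by blast
  show "?L \<subseteq> span ?Q"
  proof (rule span_minimal)
    show "epoint ` K_edges \<subseteq> span ?Q"
    proof
      fix v :: "(real ^ 'n) \<times> (real ^ 'd)" assume v: "v \<in> epoint ` K_edges"
      obtain q where q: "q \<in> ?Q" using sum_Q nonempty by blast
      have "0 \<le> v \<bullet> vvec x" for x using v by (auto simp: epoint_inner)
      then have "q + v \<in> ?Q"
        using q v by (auto simp: inner_add_left add_pos_nonneg intro: span_add span_base)
      then have "(q + v) - q \<in> span ?Q" using q by (intro span_diff span_base)
      then show "v \<in> span ?Q" by simp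
    qed
  qed simp
  show "b \<in> B'" if BB: "B \<in> ?BB" "B' \<in> ?BB" and z: "z \<in> coneof B" "z \<in> coneof B'"
    and b: "b \<in> B" "0 < coord B b z" for B B' z b
  proof -
    obtain s t where s: "s \<in> T" "B = epoint ` s" and t: "t \<in> T" "B' = epoint ` t" using BB by blast
    obtain e where e: "e \<in> s" "b = epoint e" using b s by blast
    have zs: "z \<in> span (epoint ` s)" "\<forall>b\<in>epoint ` s. 0 \<le> coord (epoint ` s) b z"
      using z(1) coneof_iff[OF basis(1)[OF s(1)]] by (auto simp: s)
    have zt: "z \<in> span (epoint ` t)" "\<forall>b\<in>epoint ` t. 0 \<le> coord (epoint ` t) b z"
      using z(2) coneof_iff[OF basis(1)[OF t(1)]] by (auto simp: t)
    have "(if e \<in> s then coord (epoint ` s) (epoint e) z else 0)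
        = (if e \<in> t then coord (epoint ` t) (epoint e) z else 0)"
      using zs zt sum_coord_epoint[OF basis(1)[OF s(1)] zs(1)] sum_coord_epoint[OF basis(1)[OF t(1)] zt(1)]
      by (intro flow_unique[OF tree_subset[OF s(1)] tree_subset[OF t(1)] no_alternating_circuit[OF s(1) t(1)]]) auto
    then show ?thesis using e b s t by (auto split: if_splits)
  qed
  show "(\<forall>z\<in>?Q. 0 < coord B b z) \<or> (\<exists>f. f \<noteq> b \<and> insert f (B - {b}) \<in> ?BB)"
    if Bb: "B \<in> ?BB" "b \<in> B" for B b
  proof -
    obtain t e where t: "t \<in> T" "B = epoint ` t" and e: "e \<in> t" "b = epoint e" using Bb by blast
    show ?thesis
    proof (cases "internal_edge t e")
      case True
      then obtain f where f: "f \<noteq> e" "insert f (t - {e}) \<in> T" using flip[OF t(1)] by blast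
      have "insert (epoint f) (B - {b}) = epoint ` insert f (t - {e})"
        using e t by (auto simp: inj_eq[OF inj_epoint])
      moreover have "epoint f \<noteq> b" using f(1) e by (simp add: inj_eq[OF inj_epoint])
      ultimately show ?thesis using f(2) by blast
    next
      case False
      then obtain x where x: "x \<in> e" "is_leaf t x" using e(1) by (auto simp: internal_edge_def)
      then have "card {g \<in> t. x \<in> g} = 1" by (simp add: is_leaf_def)
      moreover have "e \<in> {g \<in> t. x \<in> g}" using e x by simp
      ultimately have leaf: "{g \<in> t. x \<in> g} = {e}" by (metis card_1_singletonE singletonD)
      \<comment> \<open>Only \<open>e\<close> meets the leaf \<open>x\<close>, so the coordinate of
        \<open>z\<close> at the graph vertex \<open>x\<close> is the weight of \<open>e\<close>
        alone.\<close>
      have "0 < coord B b z" if z: "z \<in> ?Q" for z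
      proof -
        have zs: "z \<in> span (epoint ` t)" using z basis(2)[OF t(1)] by simp
        have "0 < z \<bullet> vvec x" using z by blast
        also have "z \<bullet> vvec x = (\<Sum>g | g \<in> t \<and> x \<in> g. coord B (epoint g) z)"
          using sum_epoint_inner[of "\<lambda>g. coord B (epoint g) z" t x]
          unfolding t(2) sum_coord_epoint[OF basis(1)[OF t(1)] zs] .
        also have "\<dots> = coord B b z" using leaf e by simp
        finally show ?thesis .
      qed
      then show ?thesis by blast
    qed
  qed
qed

lemma simplices_cover: 
  assumes z: "z \<in> simplex_product"
  shows "\<exists>t\<in>T. z \<in> convex hull (epoint ` t)"
proof -
  let ?L = "span (epoint ` K_edges) :: ((real ^ 'n) \<times> (real ^ 'd)) set"
  let ?Q = "{z \<in> ?L. \<forall>x. 0 < z \<bullet> vvec x}"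
  have zL: "z \<in> ?L" using z simplex_product_in_span by blast
  have "z \<in> \<Union>(coneof ` ((\<lambda>t. epoint ` t) ` T))"
  proof (rule cone_family.cover[OF tree_cones])
    show "(\<lambda>t. epoint ` t) ` T \<noteq> {}" using nonempty by simp
    show "z \<in> ?L" by (rule zL)
    show "z + w \<in> ?Q" if "w \<in> ?Q" for w
      using that zL z by (auto simp: mem_simplex_product inner_add_left add_nonneg_pos intro: span_add)
  qed
  then obtain t where t: "t \<in> T" "z \<in> coneof (epoint ` t)" by blast
  then obtain u where u: "z = (\<Sum>b\<in>epoint ` t. u b *\<^sub>R b)" "\<forall>b\<in>epoint ` t. 0 \<le> u b"
    unfolding coneof_def by blast
  have "1 = lsum z" using lsum_simplex_product[OF z] by simp
  also have "\<dots> = (\<Sum>b\<in>epoint ` t. u b)"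
    unfolding u(1) by (rule lsum_combination[OF tree_subset[OF t(1)]])
  finally have "z \<in> convex hull (epoint ` t)"
    unfolding convex_hull_finite[OF finite_epoint_image] using u by auto
  then show ?thesis using t(1) by blast
qed

lemma trees_encode_triangulation: "encodes_triangulation T"
proof -
  let ?P = "simplex_product :: ((real ^ 'n) \<times> (real ^ 'd)) set"
  define h :: "('n + 'd) set set \<Rightarrow> ((real ^ 'n) \<times> (real ^ 'd)) set"
    where "h A = convex hull (epoint ` A)" for A
  \<comment> \<open>A simplicial complex contains all faces of its members, including the empty one,
    so all subsets of the trees are taken.\<close>
  define \<K> where "\<K> = h ` (\<Union>t\<in>T. Pow t)"
  have indep: "\<not> affine_dependent (epoint ` A)" if "t \<in> T" "A \<subseteq> t" for t A
    using affine_independent_subset[OF spanning_tree_affine_independent[OF tree[OF that(1)]]] that(2) by blast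
  have vs: "vertex_set (h A) = epoint ` A" if "t \<in> T" "A \<subseteq> t" for t A
    unfolding vertex_set_def h_def using extreme_point_of_convex_hull_affine_independent[OF indep[OF that]] by blast
  have ad: "aff_dim (h A) = int (card A) - 1" if "t \<in> T" "A \<subseteq> t" for t A
    unfolding h_def using aff_dim_affine_independent[OF indep[OF that]]
    by (simp add: aff_dim_convex_hull card_epoint_image)
  have face: "F face_of h A \<longleftrightarrow> (\<exists>A'\<subseteq>A. F = h A')" if "t \<in> T" "A \<subseteq> t" for t A F
    unfolding h_def face_of_convex_hull_affine_independent[OF indep[OF that]]
    by (auto simp: subset_image_iff)
  have "simplicial_complex \<K>"
    unfolding simplicial_complex_def
  proof (intro conjI allI impI ballI)
    show "finite \<K>" by (simp add: \<K>_def)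
    fix S assume "S \<in> \<K>"
    then obtain t A where A: "t \<in> T" "A \<subseteq> t" "S = h A" by (auto simp: \<K>_def)
    show "\<exists>n. n simplex S"
      unfolding simplex_def
      by (rule exI[of _ "int (card (epoint ` A)) - 1"], rule exI[of _ "epoint ` A"])
        (use indep[OF A(1,2)] A(3) in \<open>simp add: h_def\<close>)
  next
    fix F S assume "S \<in> \<K> \<and> F face_of S"
    then obtain t A where A: "t \<in> T" "A \<subseteq> t" "F face_of h A" by (auto simp: \<K>_def)
    then show "F \<in> \<K>" unfolding face[OF A(1,2)] \<K>_def by blast
  next
    fix S S' assume "S \<in> \<K> \<and> S' \<in> \<K>"
    then obtain s A t B where A: "s \<in> T" "A \<subseteq> s" "S = h A" and B: "t \<in> T" "B \<subseteq> t" "S' = h B"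
      by (auto simp: \<K>_def)
    have "S \<inter> S' = h (A \<inter> B)"
      unfolding A(3) B(3) h_def by (rule hull_Int_tree_subsets[OF A(1) B(1) A(2) B(2)])
    then show "S \<inter> S' face_of S" unfolding A(3) face[OF A(1,2)] by blast
  qed
  moreover have "\<Union>\<K> = ?P"
  proof
    show "\<Union>\<K> \<subseteq> ?P"
    proof
      fix z assume "z \<in> \<Union>\<K>"
      then obtain t A where A: "t \<in> T" "A \<subseteq> t" "z \<in> h A" by (auto simp: \<K>_def)
      moreover have "h A \<subseteq> ?P"
        unfolding h_def simplex_product_hull using A tree_subset[OF A(1)] by (intro hull_mono) auto
      ultimately show "z \<in> ?P" by blast
    qed
    show "?P \<subseteq> \<Union>\<K>" using simplices_cover by (fastforce simp: \<K>_def h_def)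
  qed
  moreover have "\<forall>S\<in>\<K>. vertex_set S \<subseteq> vertex_set ?P"
  proof
    fix S assume "S \<in> \<K>"
    then obtain t A where A: "t \<in> T" "A \<subseteq> t" "S = h A" by (auto simp: \<K>_def)
    show "vertex_set S \<subseteq> vertex_set ?P"
      unfolding A(3) vs[OF A(1,2)] vertex_set_simplex_product using A(2) tree_subset[OF A(1)] by blast
  qed
  moreover have "subgraph_points ` T = vertex_set ` {S \<in> \<K>. aff_dim S = aff_dim ?P}"
  proof -
    \<comment> \<open>A subset of a tree attains the full dimension only with as many edges as the
      tree, hence only if it is the tree.\<close>
    have "{S \<in> \<K>. aff_dim S = aff_dim ?P} = h ` T"
    proof
      show "{S \<in> \<K>. aff_dim S = aff_dim ?P} \<subseteq> h ` T"
      proof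
        fix S assume "S \<in> {S \<in> \<K>. aff_dim S = aff_dim ?P}"
        then obtain t A where A: "t \<in> T" "A \<subseteq> t" "S = h A" "aff_dim (h A) = aff_dim ?P"
          by (auto simp: \<K>_def)
        then have "card A = card t"
          using ad[OF A(1,2)] aff_dim_simplex_product[OF tree[OF A(1)]] by simp
        then have "A = t" using A(2) by (metis card_subset_eq finite)
        then show "S \<in> h ` T" using A by blast
      qed
      show "h ` T \<subseteq> {S \<in> \<K>. aff_dim S = aff_dim ?P}"
        using ad aff_dim_simplex_product[OF tree] by (auto simp: \<K>_def)
    qed
    then have "vertex_set ` {S \<in> \<K>. aff_dim S = aff_dim ?P} = (\<lambda>t. vertex_set (h t)) ` T"
      by (simp add: image_image)
    also have "\<dots> = subgraph_points ` T"
    proof (rule image_cong[OF refl])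
      fix t assume t: "t \<in> T"
      show "vertex_set (h t) = subgraph_points t"
        by (simp only: vs[OF t order_refl] subgraph_points_eq[OF tree_subset[OF t]])
    qed
    finally show ?thesis by simp
  qed
  ultimately show ?thesis
    unfolding encodes_triangulation_def triangulates_without_new_vertices_def by blast
qed

end

theorem proposition7p2:
  fixes T :: "('n::finite + 'd::finite) set set set"
  assumes "T \<noteq> {}"
    and "\<And>t. t \<in> T \<Longrightarrow> t \<subseteq> K_edges"
  shows "encodes_triangulation T \<longleftrightarrow>
    (\<forall>t\<in>T. is_spanning_tree UNIV K_edges t) \<and>
    (\<forall>t\<in>T. \<forall>e. internal_edge t e \<longrightarrow>
       (\<exists>f\<in>K_edges. f \<noteq> e \<and> insert f (t - {e}) \<in> T)) \<and>
    \<not> (\<exists>s\<in>T. \<exists>t\<in>T. s \<noteq> t \<and>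
       (\<exists>c. is_circuit K_edges c \<and> alternates s t c))"
  (is "_ \<longleftrightarrow> ?trees \<and> ?flips \<and> ?no_alt")
proof
  assume "encodes_triangulation T"
  then obtain \<K> where \<K>: "triangulates_without_new_vertices \<K> (simplex_product :: ((real ^ 'n) \<times> (real ^ 'd)) set)"
    and T: "subgraph_points ` T = vertex_set ` {S \<in> \<K>. aff_dim S =
              aff_dim (simplex_product :: ((real ^ 'n) \<times> (real ^ 'd)) set)}"
    unfolding encodes_triangulation_def by blast
  have hull: "convex hull (epoint ` t) \<in> \<K>" "\<not> affine_dependent (epoint ` t)"
    "aff_dim (epoint ` t) = aff_dim (simplex_product :: ((real ^ 'n) \<times> (real ^ 'd)) set)"
    if t: "t \<in> T" for t
  proof -
    have "epoint ` t \<in> subgraph_points ` T"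
      using t subgraph_points_eq[OF assms(2)[OF t]] by (metis imageI)
    then obtain S where S: "S \<in> \<K>" "vertex_set S = epoint ` t"
      "aff_dim S = aff_dim (simplex_product :: ((real ^ 'n) \<times> (real ^ 'd)) set)"
      unfolding T by force
    obtain C where "S = convex hull C" "\<not> affine_dependent C" "vertex_set S = C"
      using member_simplex[OF \<K> S(1)] .
    with S show "convex hull (epoint ` t) \<in> \<K>" "\<not> affine_dependent (epoint ` t)"
      "aff_dim (epoint ` t) = aff_dim (simplex_product :: ((real ^ 'n) \<times> (real ^ 'd)) set)"
      by (auto simp: aff_dim_convex_hull)
  qed
  have trees: "is_spanning_tree UNIV K_edges t" if "t \<in> T" for t
    using full_simplex_imp_spanning_tree[OF assms(2) hull(2,3)] that by blast
  moreover have "\<exists>f\<in>K_edges. f \<noteq> e \<and> insert f (t - {e}) \<in> T"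
    if t: "t \<in> T" and e: "internal_edge t e" for t e
  proof -
    obtain f S' where f: "f \<in> K_edges" "f \<noteq> e" and S': "S' \<in> \<K>" "vertex_set S' = epoint ` insert f (t - {e})"
      "aff_dim S' = aff_dim (simplex_product :: ((real ^ 'n) \<times> (real ^ 'd)) set)"
      using internal_edge_flip[OF \<K> assms(2)[OF t] hull(1)[OF t] trees[OF t] hull(3)[OF t] hull(2)[OF t] e] .
    \<comment> \<open>The full-dimensional members are exactly those encoded by \<open>T\<close>, so
      the neighbour comes from some graph in \<open>T\<close>; injectivity of \<open>epoint\<close>
      identifies this graph with the exchanged one.\<close>
    have "vertex_set S' \<in> subgraph_points ` T" unfolding T using S' by blast
    then obtain t' where t': "t' \<in> T" "vertex_set S' = subgraph_points t'" by blast
    then have "epoint ` t' = epoint ` insert f (t - {e})"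
      using subgraph_points_eq[OF assms(2)[OF t'(1)]] S'(2) t'(2) by (simp only:)
    then have "t' = insert f (t - {e})" by (simp only: inj_image_eq_iff[OF inj_epoint])
    then show ?thesis using f t'(1) by blast
  qed
  moreover have "\<not> alternates s t c" if "s \<in> T" "t \<in> T" "is_circuit K_edges c" for s t c
    using no_alternating_circuit_of_members[OF \<K> assms(2) hull(1,2) assms(2) hull(1)] that by blast
  ultimately show "?trees \<and> ?flips \<and> ?no_alt" by blast
next
  assume r: "?trees \<and> ?flips \<and> ?no_alt"
  show "encodes_triangulation T"
  proof (rule trees_encode_triangulation[OF assms(1)])
    show "is_spanning_tree UNIV K_edges t" if "t \<in> T" for t
      using conjunct1[OF r] that by (rule bspec)
    show "\<exists>f\<in>K_edges. f \<noteq> e \<and> insert f (t - {e}) \<in> T" if "t \<in> T" "internal_edge t e" for t e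
      using conjunct1[OF conjunct2[OF r]] that by blast
    show "\<not> alternates s t w" if "s \<in> T" "t \<in> T" "s \<noteq> t" "is_circuit K_edges w" for s t w
      using conjunct2[OF conjunct2[OF r]] that by blast
  qed
qed

end
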